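(* Let $\lambda\in A^{\ast}$ and $\rho\in(0,\infty)$ be unknown, and consider the problem of estimating $\lambda$ and $\rho$ based on realizations $s_1,\dots,s_n$ of random strings $\sigma_1,\dots,\sigma_n$ that are (i) independent and (ii) distributed according to the Laplace-like distribution $L_{A^{\ast}}(\lambda,\rho)$, (iii) with $d=d_{H'}$ (the extended Hamming distance). Let $\check\lambda(s_1,\dots,s_n)$ and $\check\rho(s_1,\dots,s_n)$ denote the maximum likelihood estimators of $\lambda$ and $\rho$. Then there exist $N_0\in\mathbb{Z}^{+}$ and $\epsilon_0>0$ such that if $n\ge N_0$ and $\epsilon\le\epsilon_0$, we have $$\check\lambda(s_1,\dots,s_n)=\boldsymbol{m}_c^{(\epsilon)}(s_1,\dots,s_n)\quad\text{a.s.},$$ $$\check\rho(s_1,\dots,s_n)=\frac1n\sum_{i=1}^{n}d_{H'}\bigl(s_i,\boldsymbol{m}_c^{(\epsilon)}(s_1,\dots,s_n)\bigr)\quad\text{a.s.},$$ where $\boldsymbol{m}_c^{(\epsilon)}(s_1,\dots,s_n)$ is the truncated consensus sequence of $s_1,\dots,s_n$.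
   Context: **Strings.** $A=\{a_1,\dots,a_{z-1}\}$ is a finite alphabet, $e$ is the empty letter, $a_z=e$, $\bar A=A\cup\{e\}$. A string on $A$ is a sequence $s=\{x_j\in\bar A:j\in\mathbb{Z}^{+}\}$ such that $x_h=e$ for some $h$, and $x_j=e$ implies $x_{j+1}=e$. $A^{\ast}$ is the set of all strings; $o=e\cdots$ is the empty string; $|s|=\min\{h:x_h=e\}-1$. The extended Hamming distance $d_{H'}(s,t)$ is the minimum number of letter substitutions (empty letters included, so that deletion or insertion at the end counts as substitution to or from $e$) transforming $s$ into $t$, i.e. the number of sites $j$ at which $s$ and $t$ differ. **Random strings.** $(\Omega,\mathfrak F,P)$ is a probability space. A random letter is an $\bar A$-valued random variable. A random string is a sequence $\sigma=\{\alpha_j:j\in\mathbb{Z}^{+}\}$ of random letters such that for every $\omega\in\Omega$ there is $h$ with $\alpha_h(\omega)=e$, and $\alpha_j(\omega)=e$ implies $\alpha_{j+1}(\omega)=e$. Random strings $\sigma_1,\dots,\sigma_n$, $\sigma_i=\{\alpha_{ij}\}$, are independent if $\{\alpha_{1j}:j\in J_1\},\dots,\{\alpha_{nj}:j\in J_n\}$ are independent for any nonempty finite $J_1,\dots,J_n\subset\mathbb{Z}^{+}$. "S a.s." means S holds with probability one. **Laplace-like distribution.** For a distance $d$ on $A^{\ast}$ with values in $\mathbb{N}=\{0,1,\dots\}$, put $\partial U(\lambda,r)=\{t\in A^{\ast}:d(\lambda,t)=r\}$. $L_{A^{\ast}}(\lambda,\rho)$ is the distribution on $A^{\ast}$ with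 probability function $q(s;\lambda,\rho)=\frac{1}{(\rho+1)|\partial U(\lambda,d(s,\lambda))|}\left(\frac{\rho}{\rho+1}\right)^{d(s,\lambda)}$. **Truncated consensus sequence.** Let $f_{jh}$ be the relative frequency of $a_h$ at the $j$-th site of $s_1,\dots,s_n$ ($j\in\mathbb{Z}^{+}$, $1\le h\le z$). Put $j^{\ast}=\min\{j\in\mathbb{Z}^{+}:f_{jz}=\max_{1\le h\le z}f_{jh}\}-1$. For $\epsilon>0$, if $j^{\ast}\ge1$, condition $\mathrm{U}^{(\epsilon)}$ says: there exists $j\in\{1,\dots,j^{\ast}\}$ such that for every $j'\in\{j,\dots,j^{\ast}\}$, $\max_{1\le h\le z-1}f_{j'h}-\min_{1\le h\le z-1}f_{j'h}<\epsilon$. If it holds, let $j^{(\epsilon)}$ be (the smallest such $j$) $-1$. Let $\eta(j)=\arg\max_{1\le h\le z}f_{jh}$ (an arbitrary maximizer if not unique). Then $\boldsymbol{m}_c^{(\epsilon)}(s_1,\dots,s_n)$ is: $o$ if $j^{\ast}=0$, or if $j^{\ast}\ge1$, $\mathrm{U}^{(\epsilon)}$ holds and $j^{(\epsilon)}=0$; $a_{\eta(1)}\cdots a_{\eta(j^{\ast})}e\cdots$ if $j^{\ast}\ge1$ and $\mathrm{U}^{(\epsilon)}$ fails; $a_{\eta(1)}\cdots a_{\eta(j^{(\epsilon)})}e\cdots$ if $j^{\ast}\ge1$, $\mathrm{U}^{(\epsilon)}$ holds and $j^{(\epsilon)}\ge1$.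
   Formalization: A fixed N_0 makes the claim false (a sample half "a", half "b" has positive probability and breaks it), so N_0 may depend on the realization and on ε (ε>0), while ε_0 does not; the alphabet has at least two letters, as the claim fails for one letter and λ≠o. *)

theory Defs
  imports "HOL-Probability.Probability"
begin

text \<open>The alphabet is a finite type; \<open>None\<close> is the empty letter e. Sites are numbered from 0, so
  site j of the usual 1-based numbering is index \<open>j - 1\<close>.\<close>

type_synonym 'a str = "nat \<Rightarrow> 'a option"

definition strings :: "'a str set" where
  "strings = {s. (\<exists>h. s h = None) \<and> (\<forall>j. s j = None \<longrightarrow> s (Suc j) = None)}"

definition empty_str :: "'a str" where
  "empty_str = (\<lambda>_. None)"

text \<open>Extended Hamming distance: substitutions to or from the empty letter count as well.\<close>

definition hamming_dist :: "'a str \<Rightarrow> 'a str \<Rightarrow> nat" where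
  "hamming_dist s t = card {j. s j \<noteq> t j}"

definition str_sphere :: "('a str \<Rightarrow> 'a str \<Rightarrow> nat) \<Rightarrow> 'a str \<Rightarrow> nat \<Rightarrow> 'a str set" where
  "str_sphere d l r = {t \<in> strings. d l t = r}"

text \<open>Probability function of the Laplace-like distribution, for a distance \<open>d\<close>, location \<open>l\<close> and
  dispersion \<open>r\<close>.\<close>

definition laplace_prob ::
    "('a str \<Rightarrow> 'a str \<Rightarrow> nat) \<Rightarrow> 'a str \<Rightarrow> real \<Rightarrow> 'a str \<Rightarrow> real" where
  "laplace_prob d l r s =
     1 / ((r + 1) * real (card (str_sphere d l (d s l)))) * (r / (r + 1)) ^ d s l"

definition random_letter :: "'w measure \<Rightarrow> ('w \<Rightarrow> 'a option) \<Rightarrow> bool" where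
  "random_letter M \<alpha> \<longleftrightarrow> \<alpha> \<in> measurable M (count_space UNIV)"

definition random_string :: "'w measure \<Rightarrow> ('w \<Rightarrow> 'a str) \<Rightarrow> bool" where
  "random_string M \<sigma> \<longleftrightarrow>
     (\<forall>j. random_letter M (\<lambda>\<omega>. \<sigma> \<omega> j)) \<and> (\<forall>\<omega>\<in>space M. \<sigma> \<omega> \<in> strings)"

definition indep_strings :: "'w measure \<Rightarrow> nat \<Rightarrow> (nat \<Rightarrow> 'w \<Rightarrow> 'a str) \<Rightarrow> bool" where
  "indep_strings M n \<sigma> \<longleftrightarrow>
     (\<forall>J. (\<forall>i<n. finite (J i) \<and> J i \<noteq> {}) \<longrightarrow>
        prob_space.indep_vars M (\<lambda>i. \<Pi>\<^sub>M j\<in>J i. count_space UNIV)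
          (\<lambda>i \<omega>. restrict (\<sigma> i \<omega>) (J i)) {..<n})"

definition laplace_distributed ::
    "'w measure \<Rightarrow> ('a str \<Rightarrow> 'a str \<Rightarrow> nat) \<Rightarrow> 'a str \<Rightarrow> real \<Rightarrow> ('w \<Rightarrow> 'a str) \<Rightarrow> bool" where
  "laplace_distributed M d l r \<sigma> \<longleftrightarrow>
     (\<forall>s\<in>strings. measure M {\<omega> \<in> space M. \<sigma> \<omega> = s} = laplace_prob d l r s)"

definition likelihood ::
    "('a str \<Rightarrow> 'a str \<Rightarrow> nat) \<Rightarrow> 'a str list \<Rightarrow> 'a str \<Rightarrow> real \<Rightarrow> real" where
  "likelihood d ss l r = (\<Prod>s\<leftarrow>ss. laplace_prob d l r s)"

definition max_likelihood ::
    "('a str \<Rightarrow> 'a str \<Rightarrow> nat) \<Rightarrow> 'a str list \<Rightarrow> 'a str \<Rightarrow> real \<Rightarrow> bool" where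
  "max_likelihood d ss l r \<longleftrightarrow> l \<in> strings \<and> 0 < r \<and>
     (\<forall>l'\<in>strings. \<forall>r'>0. likelihood d ss l' r' \<le> likelihood d ss l r)"

definition rel_freq :: "'a str list \<Rightarrow> nat \<Rightarrow> 'a option \<Rightarrow> real" where
  "rel_freq ss j x = real (card {i. i < length ss \<and> (ss ! i) j = x}) / real (length ss)"

text \<open>The 1-based site number defining the cut minus one is exactly the 0-based index below. The same
  remark applies to \<open>uniform_start\<close>.\<close>

definition consensus_length :: "('a::finite) str list \<Rightarrow> nat" where
  "consensus_length ss = (LEAST j. rel_freq ss j None = Max (range (rel_freq ss j)))"

definition letter_spread :: "('a::finite) str list \<Rightarrow> nat \<Rightarrow> real" where
  "letter_spread ss j =
     Max (range (\<lambda>a. rel_freq ss j (Some a))) - Min (range (\<lambda>a. rel_freq ss j (Some a)))"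

definition uniform_from :: "real \<Rightarrow> ('a::finite) str list \<Rightarrow> nat \<Rightarrow> bool" where
  "uniform_from \<epsilon> ss j \<longleftrightarrow> j < consensus_length ss \<and>
     (\<forall>j'. j \<le> j' \<and> j' < consensus_length ss \<longrightarrow> letter_spread ss j' < \<epsilon>)"

definition uniform_tail :: "real \<Rightarrow> ('a::finite) str list \<Rightarrow> bool" where
  "uniform_tail \<epsilon> ss \<longleftrightarrow> (\<exists>j. uniform_from \<epsilon> ss j)"

definition uniform_start :: "real \<Rightarrow> ('a::finite) str list \<Rightarrow> nat" where
  "uniform_start \<epsilon> ss = (LEAST j. uniform_from \<epsilon> ss j)"

definition str_prefix :: "nat \<Rightarrow> (nat \<Rightarrow> 'a option) \<Rightarrow> 'a str" where
  "str_prefix k x = (\<lambda>j. if j < k then x j else None)"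

text \<open>A choice of a most frequent (possibly empty) letter at every site, ties broken arbitrarily.\<close>

definition modal_letters :: "'a str list \<Rightarrow> (nat \<Rightarrow> 'a option) \<Rightarrow> bool" where
  "modal_letters ss \<eta> \<longleftrightarrow> (\<forall>j. is_arg_max (rel_freq ss j) (\<lambda>_. True) (\<eta> j))"

definition truncated_consensus ::
    "real \<Rightarrow> ('a::finite) str list \<Rightarrow> (nat \<Rightarrow> 'a option) \<Rightarrow> 'a str" where
  "truncated_consensus \<epsilon> ss \<eta> =
     (if consensus_length ss = 0 then empty_str
      else if \<not> uniform_tail \<epsilon> ss then str_prefix (consensus_length ss) \<eta>
      else if uniform_start \<epsilon> ss = 0 then empty_str
      else str_prefix (uniform_start \<epsilon> ss) \<eta>)"

end

theory Submission
  imports Defs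
begin

text \<open>
  Almost surely, the maximum likelihood estimator of the centre and the truncated consensus sequence
  agree for large samples because both are then equal to the true centre \<open>lam\<close>. The estimator of the
  dispersion is then the mean distance from \<open>lam\<close>, since the mean distance from a given centre is the
  best dispersion for it (\<open>log_profile_less\<close>).

  The probability comes from a strong law of large numbers. The distance from the centre is
  geometrically distributed, so every function of a random string with at most linear growth in that
  distance has exponential moments. For such variables Chernoff bounds are summable, and the strong law
  follows (\<open>strong_law_exponential_moments\<close>). It is applied to countably many functions: the indicators
  of a letter at a site, the distances from all strings, the logarithms of the sphere sizes around
  all strings, and the indicator of \<open>lam\<close>. The rest is about one sequence of strings with these limits.

  For the consensus sequence, the limits of the letter frequencies have to be compared. At a site
  within \<open>lam\<close> the letter of \<open>lam\<close> is strictly most likely, also compared with the empty letter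
  (\<open>laplace_modal_letter\<close>), because strings with another letter there can be mapped injectively to
  strings with the correct letter at the same distance. Beyond the end of \<open>lam\<close> all letters are equally
  likely (\<open>laplace_uniform_letters\<close>), though possibly more likely than the empty letter, and far out the
  empty letter prevails. So the untruncated consensus may be too long, but by a bounded amount, and its
  excess part has nearly uniform letter frequencies and is cut off.

  For the likelihood, Gibbs' inequality separates the limit of the best mean log-likelihood at
  \<open>lam\<close> from the one at any other fixed centre (\<open>profile_separation\<close>). A bound that is uniform in the
  dispersion excludes all distant centres, and finitely many remain
  (\<open>eventually_unique_maximizer\<close>).
\<close>

section \<open>A strong law of large numbers\<close>

text \<open>Together with the next bound, this turns an exponential moment into a quadratic bound on the
  moment generating function near 0: the linear term vanishes for a centred variable, and the
  remainder \<open>y\<^sup>2 exp \<bar>y\<bar>\<close> is absorbed by \<open>exp (c \<bar>y\<bar>)\<close>.\<close>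

lemma exp_le_quadratic: "exp x \<le> 1 + x + x\<^sup>2 * exp \<bar>x\<bar>" for x :: real
proof -
  obtain t where t: "\<bar>t\<bar> \<le> \<bar>x\<bar>" "exp x = (\<Sum>m<2. x ^ m / fact m) + exp t / fact 2 * x ^ 2"
    using Maclaurin_exp_le[of x 2] by blast
  have "exp t / 2 \<le> exp \<bar>x\<bar>"
    using t(1) exp_gt_zero[of t] exp_le_cancel_iff[of t "\<bar>x\<bar>"] by linarith
  then have "exp t / fact 2 * x ^ 2 \<le> x\<^sup>2 * exp \<bar>x\<bar>"
    using mult_right_mono[of "exp t / 2" "exp \<bar>x\<bar>" "x\<^sup>2"] by (simp add: mult.commute)
  then show ?thesis using t(2) by (simp add: numeral_2_eq_2)
qed

lemma square_le_exp:
  fixes y c :: real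
  assumes "0 < c"
  shows "y\<^sup>2 \<le> 8 / c\<^sup>2 * exp (c / 2 * \<bar>y\<bar>)"
proof -
  have "1 + c / 2 * \<bar>y\<bar> + (c / 2 * \<bar>y\<bar>)\<^sup>2 / 2 \<le> exp (c / 2 * \<bar>y\<bar>)"
    using assms by (intro exp_lower_Taylor_quadratic) simp
  moreover have "0 \<le> c / 2 * \<bar>y\<bar>" using assms by simp
  ultimately have "(c / 2 * \<bar>y\<bar>)\<^sup>2 / 2 \<le> exp (c / 2 * \<bar>y\<bar>)" by linarith
  then show ?thesis using assms by (simp add: field_simps power2_eq_square)
qed

context prob_space
begin

lemma mgf_le_quadratic:
  fixes Y :: "'a \<Rightarrow> real"
  assumes [measurable]: "Y \<in> borel_measurable M"
    and c: "0 < c" and int: "integrable M (\<lambda>\<omega>. exp (c * \<bar>Y \<omega>\<bar>))"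
    and B: "expectation (\<lambda>\<omega>. exp (c * \<bar>Y \<omega>\<bar>)) \<le> B"
    and mean: "integrable M Y" "expectation Y = 0"
    and t: "0 < t" "t \<le> c / 2"
  shows "integrable M (\<lambda>\<omega>. exp (t * Y \<omega>))"
    and "expectation (\<lambda>\<omega>. exp (t * Y \<omega>)) \<le> exp (t\<^sup>2 * (8 / c\<^sup>2 * B))"
proof -
  have bnd: "exp (t * y) \<le> 1 + t * y + t\<^sup>2 * (8 / c\<^sup>2) * exp (c * \<bar>y\<bar>)" for y
  proof -
    have "\<bar>t * y\<bar> \<le> c / 2 * \<bar>y\<bar>"
      using t mult_right_mono[of t "c / 2" "\<bar>y\<bar>"] by (simp add: abs_mult)
    moreover have "(t * y)\<^sup>2 \<le> t\<^sup>2 * (8 / c\<^sup>2 * exp (c / 2 * \<bar>y\<bar>))"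
      unfolding power_mult_distrib by (intro mult_left_mono square_le_exp c) simp
    ultimately have "(t * y)\<^sup>2 * exp \<bar>t * y\<bar> \<le> t\<^sup>2 * (8 / c\<^sup>2 * exp (c / 2 * \<bar>y\<bar>)) * exp (c / 2 * \<bar>y\<bar>)"
      by (intro mult_mono) auto
    also have "\<dots> = t\<^sup>2 * (8 / c\<^sup>2) * exp (c * \<bar>y\<bar>)"
      by (simp add: exp_add[symmetric] field_simps)
    finally show ?thesis using exp_le_quadratic[of "t * y"] by linarith
  qed
  have intR: "integrable M (\<lambda>\<omega>. 1 + t * Y \<omega> + t\<^sup>2 * (8 / c\<^sup>2) * exp (c * \<bar>Y \<omega>\<bar>))"
    using int mean by auto
  show int': "integrable M (\<lambda>\<omega>. exp (t * Y \<omega>))"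
  proof (rule Bochner_Integration.integrable_bound[OF intR])
    show "AE \<omega> in M. norm (exp (t * Y \<omega>)) \<le>
        norm (1 + t * Y \<omega> + t\<^sup>2 * (8 / c\<^sup>2) * exp (c * \<bar>Y \<omega>\<bar>))"
      using bnd by (intro AE_I2) (smt (verit) exp_gt_zero real_norm_def)
  qed measurable
  have "expectation (\<lambda>\<omega>. exp (t * Y \<omega>)) \<le>
      expectation (\<lambda>\<omega>. 1 + t * Y \<omega> + t\<^sup>2 * (8 / c\<^sup>2) * exp (c * \<bar>Y \<omega>\<bar>))"
    using bnd by (intro integral_mono int' intR) auto
  also have "\<dots> = 1 + t\<^sup>2 * (8 / c\<^sup>2) * expectation (\<lambda>\<omega>. exp (c * \<bar>Y \<omega>\<bar>))"
    using int mean by (simp add: prob_space)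
  also have "\<dots> \<le> 1 + t\<^sup>2 * (8 / c\<^sup>2 * B)"
    using mult_left_mono[OF B, of "t\<^sup>2 * (8 / c\<^sup>2)"] by (simp add: mult.assoc)
  also have "\<dots> \<le> exp (t\<^sup>2 * (8 / c\<^sup>2 * B))" by (rule exp_ge_add_one_self)
  finally show "expectation (\<lambda>\<omega>. exp (t * Y \<omega>)) \<le> exp (t\<^sup>2 * (8 / c\<^sup>2 * B))" .
qed

text \<open>Chernoff's method: with \<open>E exp (t Y) \<le> exp (K t\<^sup>2)\<close> for small \<open>t\<close>, the probability that the sum
  exceeds \<open>n e\<close> is at most \<open>exp (K t\<^sup>2 - t e)\<close> to the power \<open>n\<close>. For small \<open>t\<close> this is a convergent
  geometric series, and the Borel-Cantelli lemma applies.\<close>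

lemma AE_eventually_sum_less:
  fixes Y :: "nat \<Rightarrow> 'a \<Rightarrow> real"
  assumes indep: "\<And>n. indep_vars (\<lambda>_. borel) Y {..<n}"
    and c: "0 < c" and int: "\<And>i. integrable M (\<lambda>\<omega>. exp (c * \<bar>Y i \<omega>\<bar>))"
    and B: "\<And>i. expectation (\<lambda>\<omega>. exp (c * \<bar>Y i \<omega>\<bar>)) \<le> B"
    and mean: "\<And>i. integrable M (Y i)" "\<And>i. expectation (Y i) = 0"
    and e: "0 < e"
  shows "AE \<omega> in M. \<forall>\<^sub>F n in sequentially. (\<Sum>i<n. Y i \<omega>) < real n * e"
proof -
  have [measurable]: "Y i \<in> borel_measurable M" for i
    using mean(1)[of i] by (rule borel_measurable_integrable)
  define K where "K = 8 / c\<^sup>2 * \<bar>B\<bar> + 1"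
  have K: "0 < K" unfolding K_def by (intro add_nonneg_pos) auto
  \<comment> \<open>At \<open>t \<le> e / (2 K)\<close> the quadratic term costs at most half of the linear gain \<open>t e\<close>.\<close>
  define t where "t = min (c / 2) (e / (2 * K))"
  have t: "0 < t" "t \<le> c / 2" using c e K by (auto simp: t_def)
  have "t * K \<le> e / 2" using K e by (auto simp: t_def min_def field_simps)
  then have tK: "t\<^sup>2 * K - t * e \<le> - (t * e / 2)"
    using t(1) mult_left_mono[of "t * K" "e / 2" t] by (simp add: power2_eq_square algebra_simps)
  define q where "q = exp (- (t * e / 2))"
  have q: "0 \<le> q" "q < 1" using t(1) e by (auto simp: q_def)
  define A where "A n = {\<omega> \<in> space M. real n * e \<le> (\<Sum>i<n. Y i \<omega>)}" for n :: nat
  have [measurable]: "A n \<in> sets M" for n unfolding A_def by measurable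
  have A: "measure M (A n) \<le> q ^ n" for n
  proof -
    have ind: "indep_vars (\<lambda>_. borel) (\<lambda>i \<omega>. exp (t * Y i \<omega>)) {..<n}"
      by (rule indep_vars_compose2[OF indep]) simp
    have intE: "integrable M (\<lambda>\<omega>. exp (t * Y i \<omega>))" for i
      by (rule mgf_le_quadratic(1)[OF _ c int B mean t]) simp
    have bE: "expectation (\<lambda>\<omega>. exp (t * Y i \<omega>)) \<le> exp (t\<^sup>2 * K)" for i
    proof -
      have "t\<^sup>2 * (8 / c\<^sup>2 * B) \<le> t\<^sup>2 * K"
        unfolding K_def by (intro mult_left_mono add_increasing2) (auto simp: divide_right_mono)
      then show ?thesis
        using mgf_le_quadratic(2)[OF _ c int B mean t, of i] by (meson exp_le_cancel_iff order_trans borel_measurable_integrable mean(1))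
    qed
    have eq: "(\<lambda>\<omega>. exp (t * (\<Sum>i<n. Y i \<omega>))) = (\<lambda>\<omega>. \<Prod>i<n. exp (t * Y i \<omega>))"
      by (simp add: sum_distrib_left exp_sum)
    have "measure M (A n) \<le> exp (- t * (real n * e)) * (\<integral>x\<in>space M. exp (t * (\<Sum>i<n. Y i x)) \<partial>M)"
      unfolding A_def using t(1) integrable_mult_indicator[OF sets.top indep_vars_integrable[OF _ ind intE]]
      by (intro Chernoff_ineq_ge) (auto simp: set_integrable_def eq)
    also have "(\<integral>x\<in>space M. exp (t * (\<Sum>i<n. Y i x)) \<partial>M) = (\<Prod>i<n. expectation (\<lambda>\<omega>. exp (t * Y i \<omega>)))"
      unfolding eq by (subst set_integral_space) (auto intro!: indep_vars_lebesgue_integral indep_vars_integrable ind intE)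
    also have "\<dots> \<le> (\<Prod>i<n. exp (t\<^sup>2 * K))"
      by (intro prod_mono conjI bE integral_nonneg) auto
    also have "exp (- t * (real n * e)) * (\<Prod>i<n. exp (t\<^sup>2 * K)) = exp (t\<^sup>2 * K - t * e) ^ n"
      by (simp add: exp_of_nat_mult[symmetric] exp_add[symmetric] algebra_simps)
    also have "\<dots> \<le> q ^ n"
      unfolding q_def using tK by (intro power_mono) auto
    finally show ?thesis by simp
  qed
  have "summable (\<lambda>n. measure M (A n))"
    using q A by (intro summable_comparison_test'[OF summable_geometric[of q], where N = 0]) auto
  then have "AE \<omega> in M. \<forall>\<^sub>F n in sequentially. \<omega> \<in> space M - A n"
    by (intro borel_cantelli_AE1) (auto simp: emeasure_eq_measure)
  then show ?thesis
    unfolding A_def by (rule AE_mp) (auto intro!: AE_I2 elim!: eventually_mono)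
qed

text \<open>The one-sided bound is used for the centred variables and for their negatives, along the
  levels \<open>1 / (m + 1)\<close>.\<close>

theorem strong_law_exponential_moments:
  fixes X :: "nat \<Rightarrow> 'a \<Rightarrow> real"
  assumes indep: "\<And>n. indep_vars (\<lambda>_. borel) X {..<n}"
    and c: "0 < c" and int: "\<And>i. integrable M (\<lambda>\<omega>. exp (c * \<bar>X i \<omega>\<bar>))"
    and B: "\<And>i. expectation (\<lambda>\<omega>. exp (c * \<bar>X i \<omega>\<bar>)) \<le> B"
    and mean: "\<And>i. integrable M (X i)" "\<And>i. expectation (X i) = \<mu>"
  shows "AE \<omega> in M. (\<lambda>n. (\<Sum>i<n. X i \<omega>) / real n) \<longlonglongrightarrow> \<mu>"
proof -
  have one_sided: "AE \<omega> in M. \<forall>\<^sub>F n in sequentially. (\<Sum>i<n. s * (X i \<omega> - \<mu>)) < real n * e"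
    if s: "\<bar>s\<bar> = 1" and e: "0 < e" for s e :: real
  proof (rule AE_eventually_sum_less[where c = c and B = "exp (c * \<bar>\<mu>\<bar>) * B"])
    have [measurable]: "X i \<in> borel_measurable M" for i
      using mean(1)[of i] by (rule borel_measurable_integrable)
    have bnd: "exp (c * \<bar>s * (X i \<omega> - \<mu>)\<bar>) \<le> exp (c * \<bar>\<mu>\<bar>) * exp (c * \<bar>X i \<omega>\<bar>)" for i \<omega>
    proof -
      have "c * \<bar>s * (X i \<omega> - \<mu>)\<bar> \<le> c * (\<bar>\<mu>\<bar> + \<bar>X i \<omega>\<bar>)"
        using c s by (intro mult_left_mono) (auto simp: abs_mult)
      then show ?thesis by (simp add: exp_add[symmetric] algebra_simps)
    qed
    show i: "integrable M (\<lambda>\<omega>. exp (c * \<bar>s * (X i \<omega> - \<mu>)\<bar>))" for i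
      by (rule Bochner_Integration.integrable_bound
          [OF integrable_mult_right[OF int[of i], of "exp (c * \<bar>\<mu>\<bar>)"]]) (use bnd[of i] in auto)
    show "expectation (\<lambda>\<omega>. exp (c * \<bar>s * (X i \<omega> - \<mu>)\<bar>)) \<le> exp (c * \<bar>\<mu>\<bar>) * B" for i
    proof -
      have "expectation (\<lambda>\<omega>. exp (c * \<bar>s * (X i \<omega> - \<mu>)\<bar>)) \<le>
          expectation (\<lambda>\<omega>. exp (c * \<bar>\<mu>\<bar>) * exp (c * \<bar>X i \<omega>\<bar>))"
        by (intro integral_mono i integrable_mult_right int bnd)
      also have "\<dots> \<le> exp (c * \<bar>\<mu>\<bar>) * B" using B[of i] by simp
      finally show ?thesis .
    qed
    show "indep_vars (\<lambda>_. borel) (\<lambda>i \<omega>. s * (X i \<omega> - \<mu>)) {..<n}" for n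
      by (rule indep_vars_compose2[OF indep]) simp
  qed (use mean c e in \<open>auto simp: prob_space\<close>)
  have "AE \<omega> in M. \<forall>m. \<forall>s\<in>{1, -1}. \<forall>\<^sub>F n in sequentially. (\<Sum>i<n. s * (X i \<omega> - \<mu>)) < real n * (1 / real (Suc m))"
    unfolding AE_all_countable by (intro allI AE_ball_countable' one_sided) auto
  then show ?thesis
  proof (rule AE_mp, intro AE_I2 impI)
    fix \<omega>
    assume *: "\<forall>m. \<forall>s\<in>{1, -1}. \<forall>\<^sub>F n in sequentially. (\<Sum>i<n. s * (X i \<omega> - \<mu>)) < real n * (1 / real (Suc m))"
    show "(\<lambda>n. (\<Sum>i<n. X i \<omega>) / real n) \<longlonglongrightarrow> \<mu>"
    proof (rule tendstoI)
      fix e :: real assume "0 < e"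
      then obtain m where m: "1 / real (Suc m) < e"
        using nat_approx_posE by blast
      define \<delta> where "\<delta> = 1 / real (Suc m)"
      have "\<forall>\<^sub>F n in sequentially. (\<Sum>i<n. 1 * (X i \<omega> - \<mu>)) < real n * \<delta>"
        "\<forall>\<^sub>F n in sequentially. (\<Sum>i<n. (-1) * (X i \<omega> - \<mu>)) < real n * \<delta>"
        unfolding \<delta>_def using * by blast+
      then show "\<forall>\<^sub>F n in sequentially. dist ((\<Sum>i<n. X i \<omega>) / real n) \<mu> < e"
        using eventually_gt_at_top[of 0]
      proof eventually_elim
        case (elim n)
        have "\<bar>(\<Sum>i<n. X i \<omega>) / real n - \<mu>\<bar> < \<delta>"
          using elim by (simp add: sum_subtractf sum_negf abs_less_iff field_simps)
        then show ?case using m by (simp add: dist_real_def \<delta>_def)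
      qed
    qed
  qed
qed

end

section \<open>Strings and the extended Hamming distance\<close>

lemma string_None_mono: "s \<in> strings \<Longrightarrow> s i = None \<Longrightarrow> i \<le> j \<Longrightarrow> s j = None"
  by (induction j rule: nat_induct) (auto simp: strings_def le_Suc_eq)

definition str_length :: "'a str \<Rightarrow> nat" where
  "str_length s = (LEAST h. s h = None)"

lemma string_None_iff:
  assumes "s \<in> strings"
  shows "s j = None \<longleftrightarrow> str_length s \<le> j"
proof
  show "s j = None \<Longrightarrow> str_length s \<le> j" unfolding str_length_def by (rule Least_le)
  have "s (str_length s) = None"
    unfolding str_length_def by (rule LeastI_ex) (use assms in \<open>simp add: strings_def\<close>)
  then show "str_length s \<le> j \<Longrightarrow> s j = None" using string_None_mono[OF assms] by blast
qed

lemma stringI: "(\<And>j. s j = None \<longleftrightarrow> m \<le> j) \<Longrightarrow> s \<in> strings"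
  unfolding strings_def by auto

lemma str_length_eqI: "(\<And>j. s j = None \<longleftrightarrow> m \<le> j) \<Longrightarrow> str_length s = m"
  unfolding str_length_def by (rule Least_equality) auto

lemma finite_differences:
  assumes "s \<in> strings" "t \<in> strings"
  shows "finite {j. s j \<noteq> t j}"
proof (rule finite_subset)
  show "{j. s j \<noteq> t j} \<subseteq> {..<max (str_length s) (str_length t)}"
    using string_None_iff[OF assms(1)] string_None_iff[OF assms(2)] by (auto simp: less_max_iff_disj) (metis leI)
qed simp

lemma hamming_dist_commute: "hamming_dist s t = hamming_dist t s"
  unfolding hamming_dist_def by (simp only: eq_commute[of "s _"])

lemma hamming_dist_self [simp]: "hamming_dist s s = 0"
  unfolding hamming_dist_def by simp

lemma hamming_dist_eq_0_iff:
  "s \<in> strings \<Longrightarrow> t \<in> strings \<Longrightarrow> hamming_dist s t = 0 \<longleftrightarrow> s = t"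
  unfolding hamming_dist_def by (auto simp: finite_differences)

lemma hamming_dist_triangle:
  assumes "s \<in> strings" "t \<in> strings" "u \<in> strings"
  shows "hamming_dist s u \<le> hamming_dist s t + hamming_dist t u"
proof -
  have "card {j. s j \<noteq> u j} \<le> card ({j. s j \<noteq> t j} \<union> {j. t j \<noteq> u j})"
    by (intro card_mono finite_UnI finite_differences assms) auto
  also have "\<dots> \<le> card {j. s j \<noteq> t j} + card {j. t j \<noteq> u j}" by (rule card_Un_le)
  finally show ?thesis unfolding hamming_dist_def .
qed

text \<open>The sites between the two lengths carry a letter in one string only, so each of them counts.
  Hence a sphere lies in a set of strings of bounded length, which makes it finite and its
  cardinality at most exponential in the radius.\<close>

lemma str_length_le_add_dist:
  assumes "l \<in> strings" "t \<in> strings"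
  shows "str_length t \<le> str_length l + hamming_dist l t"
proof -
  have "{str_length l..<str_length t} \<subseteq> {j. l j \<noteq> t j}"
    using string_None_iff[OF assms(1)] string_None_iff[OF assms(2)] by (auto) (metis leD)
  then have "card {str_length l..<str_length t} \<le> hamming_dist l t"
    unfolding hamming_dist_def by (intro card_mono finite_differences assms)
  then show ?thesis by simp
qed

lemma strings_length_bounded:
  fixes m :: nat
  shows "finite {t \<in> (strings :: ('a::finite) str set). str_length t \<le> m}"
    and "card {t \<in> (strings :: ('a::finite) str set). str_length t \<le> m} \<le> (CARD('a) + 1) ^ m"
proof -
  let ?S = "{t \<in> (strings :: 'a str set). str_length t \<le> m}"
  have inj: "inj_on (\<lambda>t. restrict t {..<m}) ?S"
  proof (rule inj_onI, rule ext)
    fix s t j assume s: "s \<in> ?S" and t: "t \<in> ?S" and eq: "restrict s {..<m} = restrict t {..<m}"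
    show "s j = t j"
    proof (cases "j < m")
      case True then show ?thesis using fun_cong[OF eq, of j] by simp
    next
      case False
      then have "s j = None" "t j = None" using s t string_None_iff by fastforce+
      then show ?thesis by simp
    qed
  qed
  have sub: "(\<lambda>t. restrict t {..<m}) ` ?S \<subseteq> (\<Pi>\<^sub>E j\<in>{..<m}. UNIV)" by (rule image_subsetI) (simp add: restrict_PiE)
  have fin: "finite (\<Pi>\<^sub>E j\<in>{..<m}. (UNIV :: 'a option set))" by (intro finite_PiE) auto
  show "finite ?S" by (rule inj_on_finite[OF inj sub fin])
  have "card ?S \<le> card (\<Pi>\<^sub>E j\<in>{..<m}. (UNIV :: 'a option set))"
    by (rule card_inj_on_le[OF inj sub fin])
  also have "\<dots> = (CARD('a) + 1) ^ m" by (simp add: card_PiE card_UNIV_option)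
  finally show "card ?S \<le> (CARD('a) + 1) ^ m" .
qed

lemma
  fixes l :: "('a::finite) str"
  assumes "l \<in> strings"
  shows finite_str_sphere: "finite (str_sphere hamming_dist l r)"
    and card_str_sphere_le: "card (str_sphere hamming_dist l r) \<le> (CARD('a) + 1) ^ (str_length l + r)"
proof -
  have sub: "str_sphere hamming_dist l r \<subseteq> {t \<in> strings. str_length t \<le> str_length l + r}"
    using str_length_le_add_dist[OF assms] by (auto simp: str_sphere_def)
  show "finite (str_sphere hamming_dist l r)"
    by (rule finite_subset[OF sub strings_length_bounded(1)])
  show "card (str_sphere hamming_dist l r) \<le> (CARD('a) + 1) ^ (str_length l + r)"
    using card_mono[OF strings_length_bounded(1) sub] strings_length_bounded(2) order_trans by blast
qed

text \<open>Appending \<open>r\<close> letters to the centre is a way to reach every radius; \<open>undefined\<close> is an arbitrary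
  letter. Without this the distances would not be geometrically distributed.\<close>

lemma str_sphere_nonempty:
  assumes "l \<in> strings"
  shows "str_sphere hamming_dist l r \<noteq> {}"
proof -
  define t :: "'a str" where
    "t j = (if j < str_length l then l j else if j < str_length l + r then Some undefined else None)" for j
  have "t j = None \<longleftrightarrow> str_length l + r \<le> j" for j
    using string_None_iff[OF assms, of j] by (auto simp: t_def)
  then have "t \<in> strings" by (rule stringI)
  moreover have "{j. l j \<noteq> t j} = {str_length l..<str_length l + r}"
    using string_None_iff[OF assms] by (auto simp: t_def split: if_splits) (metis leI option.distinct(1))
  then have "hamming_dist l t = r" by (simp add: hamming_dist_def)
  ultimately show ?thesis by (auto simp: str_sphere_def)
qed

lemma strings_eq_UN_str_sphere: "strings = (\<Union>r. str_sphere hamming_dist l r)"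
  by (auto simp: str_sphere_def)

lemma str_sphere_center: "l \<in> strings \<Longrightarrow> str_sphere hamming_dist l 0 = {l}"
  using hamming_dist_eq_0_iff by (auto simp: str_sphere_def)

lemma countable_strings: "countable (strings :: ('a::finite) str set)"
proof -
  have "(\<lambda>_. None) \<in> (strings :: 'a str set)" by (simp add: strings_def)
  from finite_str_sphere[OF this] show ?thesis
    by (subst strings_eq_UN_str_sphere[of "\<lambda>_. None"]) (auto intro: countable_finite)
qed

lemma card_str_sphere_pos:
  "l \<in> strings \<Longrightarrow> 0 < card (str_sphere hamming_dist l r)" for l :: "('a::finite) str"
  by (simp add: card_gt_0_iff finite_str_sphere str_sphere_nonempty)

section \<open>The Laplace-like distribution\<close>

text \<open>The distribution is built as a two-stage experiment, a geometric radius followed by a uniform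
  point on the sphere. That the total mass is one and that the distance is geometric is then
  immediate, and the probability function is recovered in \<open>pmf_laplace_pmf\<close>.\<close>

definition laplace_pmf :: "('a::finite) str \<Rightarrow> real \<Rightarrow> 'a str pmf" where
  "laplace_pmf l r = bind_pmf (geometric_pmf (1 / (r + 1))) (\<lambda>d. pmf_of_set (str_sphere hamming_dist l d))"

context
  fixes l :: "('a::finite) str" and r :: real
  assumes l: "l \<in> strings" and r: "0 < r"
begin

lemma set_laplace_pmf: "set_pmf (laplace_pmf l r) = strings"
  using r unfolding laplace_pmf_def
  by (simp add: set_pmf_geometric set_pmf_of_set finite_str_sphere[OF l] str_sphere_nonempty[OF l]
      strings_eq_UN_str_sphere[of l, symmetric])

lemma map_hamming_dist_laplace_pmf:
  "map_pmf (hamming_dist l) (laplace_pmf l r) = geometric_pmf (1 / (r + 1))"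
proof -
  have "map_pmf (hamming_dist l) (pmf_of_set (str_sphere hamming_dist l d)) = return_pmf d" for d
  proof -
    have "map_pmf (hamming_dist l) (pmf_of_set (str_sphere hamming_dist l d)) =
        map_pmf (\<lambda>_. d) (pmf_of_set (str_sphere hamming_dist l d))"
    proof (rule map_pmf_cong[OF refl])
      fix t assume "t \<in> set_pmf (pmf_of_set (str_sphere hamming_dist l d))"
      then have "t \<in> str_sphere hamming_dist l d"
        by (simp add: set_pmf_of_set finite_str_sphere[OF l] str_sphere_nonempty[OF l])
      then show "hamming_dist l t = d" by (simp add: str_sphere_def)
    qed
    then show ?thesis by simp
  qed
  then show ?thesis by (simp add: laplace_pmf_def map_bind_pmf bind_return_pmf')
qed

lemma pmf_laplace_pmf:
  assumes s: "s \<in> strings"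
  shows "pmf (laplace_pmf l r) s = laplace_prob hamming_dist l r s"
proof -
  let ?S = "str_sphere hamming_dist l" and ?d = "hamming_dist l s"
  have "pmf (pmf_of_set (?S d)) s = indicator {?d} d / card (?S ?d)" for d
    unfolding pmf_of_set[OF str_sphere_nonempty[OF l] finite_str_sphere[OF l]]
    using s by (auto simp: str_sphere_def indicator_def)
  then have "pmf (laplace_pmf l r) s =
      measure_pmf.expectation (geometric_pmf (1 / (r + 1))) (\<lambda>d. indicator {?d} d / card (?S ?d))"
    by (simp add: laplace_pmf_def pmf_bind)
  also have "\<dots> = pmf (geometric_pmf (1 / (r + 1))) ?d / card (?S ?d)"
    by (simp add: measure_pmf_single)
  also have "\<dots> = laplace_prob hamming_dist l r s"
    using r by (simp add: laplace_prob_def hamming_dist_commute[of s l] field_simps)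
  finally show ?thesis .
qed

end

lemma integrable_exp_geometric_pmf:
  assumes p: "0 < p" "p \<le> 1" and c: "exp c * (1 - p) < 1"
  shows "integrable (geometric_pmf p) (\<lambda>n. exp (c * real n))"
proof -
  have "summable (\<lambda>n. p * (exp c * (1 - p)) ^ n)"
    using p c by (intro summable_mult summable_geometric) auto
  then have "summable (\<lambda>n. (1 - p) ^ n * p * exp (c * real n))"
    by (simp add: power_mult_distrib exp_of_nat_mult[symmetric] mult.commute mult.left_commute)
  then show ?thesis
    unfolding measure_pmf_eq_density using p
    by (subst integrable_density) (auto simp: integrable_count_space_nat_iff mult_ac)
qed

context
  fixes l :: "('a::finite) str" and r :: real
  assumes l: "l \<in> strings" and r: "0 < r"
begin

text \<open>Only functions that grow at most linearly in the distance from the centre are averaged below,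
  and the distance is geometric.\<close>

lemma laplace_exponential_moment:
  fixes f :: "'a str \<Rightarrow> real"
  assumes f: "\<And>s. s \<in> strings \<Longrightarrow> \<bar>f s\<bar> \<le> a + b * real (hamming_dist l s)"
  obtains c where "0 < c" "integrable (laplace_pmf l r) (\<lambda>s. exp (c * \<bar>f s\<bar>))"
proof -
  define p where "p = 1 / (r + 1)"
  have p: "0 < p" "p < 1" using r by (auto simp: p_def)
  define b' where "b' = \<bar>b\<bar> + 1"
  have b': "0 < b'" "b \<le> b'" by (auto simp: b'_def)
  \<comment> \<open>Any rate below \<open>- ln (1 - p) / b'\<close> leaves a convergent geometric series.\<close>
  define c where "c = - ln (1 - p) / (2 * b')"
  have lnp: "ln (1 - p) < 0" using p by (subst ln_less_zero_iff) auto
  have c: "0 < c" unfolding c_def using lnp b' by (intro divide_pos_pos) auto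
  have cb: "c * b' = - ln (1 - p) / 2" using b' by (simp add: c_def)
  have "exp (c * b') * (1 - p) = exp (ln (1 - p) / 2)"
  proof -
    have "exp (c * b') * (1 - p) = exp (c * b' + ln (1 - p))"
      using p by (simp add: exp_add)
    then show ?thesis unfolding cb by simp
  qed
  also have "\<dots> < 1" using lnp by simp
  finally have "integrable (geometric_pmf p) (\<lambda>n. exp (c * b' * real n))"
    using p by (intro integrable_exp_geometric_pmf) auto
  then have "integrable (laplace_pmf l r) (\<lambda>s. exp (c * b' * real (hamming_dist l s)))"
    using map_hamming_dist_laplace_pmf[OF l r, folded p_def]
      integrable_map_pmf_eq[of "hamming_dist l" "laplace_pmf l r" "\<lambda>n. exp (c * b' * real n)"] by simp
  then have "integrable (laplace_pmf l r) (\<lambda>s. exp (c * a) * exp (c * b' * real (hamming_dist l s)))"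
    by simp
  then have "integrable (laplace_pmf l r) (\<lambda>s. exp (c * \<bar>f s\<bar>))"
  proof (rule Bochner_Integration.integrable_bound)
    show "AE s in laplace_pmf l r. norm (exp (c * \<bar>f s\<bar>)) \<le>
        norm (exp (c * a) * exp (c * b' * real (hamming_dist l s)))"
      unfolding AE_measure_pmf_iff set_laplace_pmf[OF l r]
    proof
      fix s :: "'a str" assume "s \<in> strings"
      from f[OF this] have "\<bar>f s\<bar> \<le> a + b' * real (hamming_dist l s)"
        using mult_right_mono[OF b'(2), of "real (hamming_dist l s)"] by linarith
      then have "c * \<bar>f s\<bar> \<le> c * (a + b' * real (hamming_dist l s))"
        using c by (intro mult_left_mono) auto
      then show "norm (exp (c * \<bar>f s\<bar>)) \<le> norm (exp (c * a) * exp (c * b' * real (hamming_dist l s)))"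
        by (simp add: exp_add[symmetric] algebra_simps)
    qed
  qed simp
  with c show thesis by (rule that)
qed

text \<open>A positive exponential moment dominates the function itself, since \<open>y \<le> exp (c y) / c\<close>.\<close>

lemma laplace_integrable:
  fixes f :: "'a str \<Rightarrow> real"
  assumes "\<And>s. s \<in> strings \<Longrightarrow> \<bar>f s\<bar> \<le> a + b * real (hamming_dist l s)"
  shows "integrable (laplace_pmf l r) f"
proof -
  obtain c where c: "0 < c" and i: "integrable (laplace_pmf l r) (\<lambda>s. exp (c * \<bar>f s\<bar>))"
    using laplace_exponential_moment[of f a b] assms by blast
  from i have "integrable (laplace_pmf l r) (\<lambda>s. exp (c * \<bar>f s\<bar>) / c)" by simp
  then show ?thesis
  proof (rule Bochner_Integration.integrable_bound)
    have "\<bar>f s\<bar> \<le> exp (c * \<bar>f s\<bar>) / c" for s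
    proof -
      have "c * \<bar>f s\<bar> \<le> exp (c * \<bar>f s\<bar>)" using exp_ge_add_one_self[of "c * \<bar>f s\<bar>"] by linarith
      then show ?thesis using c by (simp add: field_simps)
    qed
    then show "AE s in laplace_pmf l r. norm (f s) \<le> norm (exp (c * \<bar>f s\<bar>) / c)"
      using c by (intro AE_I2) simp
  qed simp
qed

end

section \<open>The sample and its averages\<close>

locale laplace_sample = prob_space M for M :: "'w measure" +
  fixes \<sigma> :: "nat \<Rightarrow> 'w \<Rightarrow> ('a::finite) str" and lam :: "'a str" and \<rho> :: real
  assumes lam: "lam \<in> strings" and \<rho>: "0 < \<rho>"
    and random: "\<And>i. random_string M (\<sigma> i)"
    and indep: "\<And>n. indep_strings M n \<sigma>"
    and distr: "\<And>i. laplace_distributed M hamming_dist lam \<rho> (\<sigma> i)"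
begin

lemma sample_in_strings: "\<omega> \<in> space M \<Longrightarrow> \<sigma> i \<omega> \<in> strings"
  using random by (simp add: random_string_def)

lemma measurable_sample: "\<sigma> i \<in> measurable M (count_space strings)"
proof (subst measurable_count_space_eq_countable[OF countable_strings], intro conjI ballI)
  show "\<sigma> i \<in> space M \<rightarrow> strings" using sample_in_strings by auto
next
  fix s :: "'a str"
  have "(\<lambda>\<omega>. \<sigma> i \<omega> j) -` {s j} \<inter> space M \<in> sets M" for j
    using random[of i] by (intro measurable_sets[where A = "count_space UNIV"])
      (auto simp: random_string_def random_letter_def)
  then have "(\<Inter>j. (\<lambda>\<omega>. \<sigma> i \<omega> j) -` {s j} \<inter> space M) \<in> sets M"
    by (intro sets.countable_INT) auto
  moreover have "\<sigma> i -` {s} \<inter> space M = (\<Inter>j. (\<lambda>\<omega>. \<sigma> i \<omega> j) -` {s j} \<inter> space M)"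
    by (auto simp: fun_eq_iff)
  ultimately show "\<sigma> i -` {s} \<inter> space M \<in> sets M" by simp
qed

lemma measurable_sample_UNIV [measurable]: "\<sigma> i \<in> measurable M (count_space UNIV)"
  by (rule measurable_compose[OF measurable_sample, of "\<lambda>s. s"]) simp

lemma distr_sample: "distr M (count_space UNIV) (\<sigma> i) = measure_pmf (laplace_pmf lam \<rho>)"
proof (rule measure_eqI_countable_AE[where \<Omega> = strings])
  show "AE s in distr M (count_space UNIV) (\<sigma> i). s \<in> strings"
    by (subst AE_distr_iff) (simp_all add: sample_in_strings)
  show "AE s in laplace_pmf lam \<rho>. s \<in> strings"
    by (simp add: AE_measure_pmf_iff set_laplace_pmf[OF lam \<rho>])
  fix s :: "'a str" assume s: "s \<in> strings"
  have "emeasure (distr M (count_space UNIV) (\<sigma> i)) {s} = ennreal (prob {\<omega> \<in> space M. \<sigma> i \<omega> = s})"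
    by (subst emeasure_distr) (auto simp: emeasure_eq_measure vimage_def Int_def conj_commute)
  also have "\<dots> = ennreal (pmf (laplace_pmf lam \<rho>) s)"
    using distr[of i] s by (simp add: laplace_distributed_def pmf_laplace_pmf[OF lam \<rho>])
  finally show "emeasure (distr M (count_space UNIV) (\<sigma> i)) {s} = emeasure (laplace_pmf lam \<rho>) {s}"
    by (simp add: emeasure_pmf_single)
qed (auto simp: countable_strings)

text \<open>A random string equals \<open>s\<close> as soon as it agrees with \<open>s\<close> up to and including the first empty
  site of \<open>s\<close>. Independence of the strings on finite sets of sites therefore speaks about the
  events \<open>\<sigma> i = s\<close>, which generate all subsets of the countable set of strings. The trivial events
  need some nonempty set of sites, for which site 0 serves.\<close>

lemma sample_event_finite_sites:
  assumes "A \<in> insert {} (insert strings ((\<lambda>s. {s}) ` strings))"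
  shows "\<exists>J B. finite J \<and> J \<noteq> {} \<and> B \<in> sets (\<Pi>\<^sub>M j\<in>J. count_space UNIV) \<and>
    (\<forall>i. \<sigma> i -` A \<inter> space M = (\<lambda>\<omega>. restrict (\<sigma> i \<omega>) J) -` B \<inter> space M)"
proof -
  consider "A = {}" | "A = strings" | s where "s \<in> strings" "A = {s}" using assms by auto
  then show ?thesis
  proof cases
    case 1
    show ?thesis by (rule exI[of _ "{0}"], rule exI[of _ "{}"]) (simp add: 1)
  next
    case 2
    have "\<sigma> i -` A \<inter> space M = (\<lambda>\<omega>. restrict (\<sigma> i \<omega>) {0}) -` (\<Pi>\<^sub>E j\<in>{0}. UNIV) \<inter> space M" for i
      using sample_in_strings by (auto simp: 2 PiE_iff)
    moreover have "(\<Pi>\<^sub>E j\<in>{0}. UNIV) \<in> sets (\<Pi>\<^sub>M j\<in>{0::nat}. count_space (UNIV :: 'a option set))"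
      by (rule sets_PiM_I_finite) auto
    ultimately show ?thesis
      by (intro exI[of _ "{0}"] exI[of _ "\<Pi>\<^sub>E j\<in>{0}. UNIV"] conjI allI) auto
  next
    case (3 s)
    let ?J = "{..str_length s}"
    have "\<sigma> i \<omega> = s" if "\<omega> \<in> space M" and eq: "\<forall>j\<in>?J. \<sigma> i \<omega> j = s j" for i \<omega>
    proof
      fix j
      have N: "s (str_length s) = None" "\<sigma> i \<omega> (str_length s) = None"
        using string_None_iff[OF \<open>s \<in> strings\<close>] eq by auto
      show "\<sigma> i \<omega> j = s j"
      proof (cases "j \<le> str_length s")
        case True then show ?thesis using eq by simp
      next
        case False
        then show ?thesis
          using N string_None_mono[OF sample_in_strings[OF \<open>\<omega> \<in> space M\<close>], of i "str_length s" j]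
            string_None_mono[OF \<open>s \<in> strings\<close>, of "str_length s" j] by simp
      qed
    qed
    then have "\<sigma> i -` A \<inter> space M = (\<lambda>\<omega>. restrict (\<sigma> i \<omega>) ?J) -` (\<Pi>\<^sub>E j\<in>?J. {s j}) \<inter> space M" for i
      by (auto simp: 3 PiE_iff)
    moreover have "(\<Pi>\<^sub>E j\<in>?J. {s j}) \<in> sets (\<Pi>\<^sub>M j\<in>?J. count_space UNIV)"
      by (intro sets_PiM_I_finite) auto
    ultimately show ?thesis by (intro exI[of _ ?J] exI[of _ "\<Pi>\<^sub>E j\<in>?J. {s j}"] conjI allI) auto
  qed
qed

text \<open>The singletons, with the two trivial events, form a generator closed under intersection. The
  set of all functions into letters is uncountable, so this works only because the strings are
  taken as values in \<open>strings\<close>.\<close>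

lemma indep_sample: "indep_vars (\<lambda>_. count_space strings) \<sigma> {..<n}"
proof (cases "n = 0")
  case True
  then show ?thesis by (simp add: indep_vars_def indep_sets_def)
next
  case False
  define E :: "'a str set set" where "E = insert {} (insert strings ((\<lambda>s. {s}) ` strings))"
  define R where "R A J B \<longleftrightarrow> finite J \<and> J \<noteq> {} \<and> B \<in> sets (\<Pi>\<^sub>M j\<in>J. count_space UNIV) \<and>
    (\<forall>i. \<sigma> i -` A \<inter> space M = (\<lambda>\<omega>. restrict (\<sigma> i \<omega>) J) -` B \<inter> space M)"
    for A :: "'a str set" and J :: "nat set" and B
  have "\<exists>J B. R A J B" if "A \<in> E" for A
    unfolding R_def using that by (intro sample_event_finite_sites) (simp add: E_def)
  then obtain J B where R: "\<And>A. A \<in> E \<Longrightarrow> R A (J A) (B A)"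
    by metis
  note JB = R[unfolded R_def]
  have "indep_vars (\<lambda>_. count_space strings) \<sigma> {..<n} \<longleftrightarrow>
    (\<forall>A\<in>{..<n} \<rightarrow> E. prob (\<Inter>j\<in>{..<n}. \<sigma> j -` A j \<inter> space M) = (\<Prod>j\<in>{..<n}. prob (\<sigma> j -` A j \<inter> space M)))"
  proof (rule indep_vars_finite)
    show "{..<n} \<noteq> {}" using False by auto
    have "Pow strings = sigma_sets strings E"
    proof
      interpret S: sigma_algebra strings "sigma_sets strings E"
        by (rule sigma_algebra_sigma_sets) (auto simp: E_def)
      have "A \<in> sigma_sets strings E" if "A \<subseteq> strings" for A
      proof -
        have "(\<Union>s\<in>A. {s}) \<in> sigma_sets strings E"
          using that by (intro S.countable_UN' countable_subset[OF that countable_strings])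
            (auto intro!: sigma_sets.Basic simp: E_def)
        then show ?thesis by simp
      qed
      then show "Pow strings \<subseteq> sigma_sets strings E" by auto
      show "sigma_sets strings E \<subseteq> Pow strings"
        using sigma_sets_into_sp[of E strings] by (auto simp: E_def)
    qed
    then show "sets (count_space strings) = sigma_sets (space (count_space strings)) E" by simp
    show "Int_stable E"
    proof (rule Int_stableI)
      fix A B assume "A \<in> E" "B \<in> E"
      then have "A \<inter> B = {} \<or> A \<inter> B = A \<or> A \<inter> B = B" unfolding E_def by auto
      with \<open>A \<in> E\<close> \<open>B \<in> E\<close> show "A \<inter> B \<in> E" by (auto simp: E_def)
    qed
  qed (auto simp: measurable_sample E_def)
  moreover have "prob (\<Inter>j\<in>{..<n}. \<sigma> j -` A j \<inter> space M) = (\<Prod>j\<in>{..<n}. prob (\<sigma> j -` A j \<inter> space M))"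
    if A: "A \<in> {..<n} \<rightarrow> E" for A
  proof -
    have AE: "A i \<in> E" if "i < n" for i using A that by (simp add: Pi_iff)
    have "indep_vars (\<lambda>i. \<Pi>\<^sub>M j\<in>J (A i). count_space UNIV) (\<lambda>i \<omega>. restrict (\<sigma> i \<omega>) (J (A i))) {..<n}"
      using indep[of n, unfolded indep_strings_def, rule_format, of "\<lambda>i. J (A i)"] JB[OF AE] by simp
    then have "prob (\<Inter>i\<in>{..<n}. (\<lambda>\<omega>. restrict (\<sigma> i \<omega>) (J (A i))) -` B (A i) \<inter> space M) =
        (\<Prod>i\<in>{..<n}. prob ((\<lambda>\<omega>. restrict (\<sigma> i \<omega>) (J (A i))) -` B (A i) \<inter> space M))"
      by (rule indep_varsD_finite) (use False JB[OF AE] in \<open>simp_all add: lessThan_empty_iff\<close>)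
    moreover have eq: "\<sigma> i -` A i \<inter> space M = (\<lambda>\<omega>. restrict (\<sigma> i \<omega>) (J (A i))) -` B (A i) \<inter> space M"
      if "i \<in> {..<n}" for i using JB[OF AE] that by simp
    moreover have "(\<Inter>i\<in>{..<n}. \<sigma> i -` A i \<inter> space M) =
        (\<Inter>i\<in>{..<n}. (\<lambda>\<omega>. restrict (\<sigma> i \<omega>) (J (A i))) -` B (A i) \<inter> space M)"
      by (intro INF_cong eq) auto
    moreover have "(\<Prod>i\<in>{..<n}. prob (\<sigma> i -` A i \<inter> space M)) =
        (\<Prod>i\<in>{..<n}. prob ((\<lambda>\<omega>. restrict (\<sigma> i \<omega>) (J (A i))) -` B (A i) \<inter> space M))"
      by (intro prod.cong refl arg_cong[of _ _ prob] eq)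
    ultimately show ?thesis by (simp only:)
  qed
  ultimately show ?thesis by blast
qed

lemma strong_law_sample:
  fixes f :: "'a str \<Rightarrow> real"
  assumes f: "\<And>s. s \<in> strings \<Longrightarrow> \<bar>f s\<bar> \<le> a + b * real (hamming_dist lam s)"
  shows "AE \<omega> in M. (\<lambda>n. (\<Sum>i<n. f (\<sigma> i \<omega>)) / real n) \<longlonglongrightarrow>
    measure_pmf.expectation (laplace_pmf lam \<rho>) f"
proof -
  obtain c where c: "0 < c" and i: "integrable (laplace_pmf lam \<rho>) (\<lambda>s. exp (c * \<bar>f s\<bar>))"
    using laplace_exponential_moment[OF lam \<rho>, of f a b] f by blast
  have int: "integrable M (\<lambda>\<omega>. g (\<sigma> i \<omega>)) \<longleftrightarrow> integrable (laplace_pmf lam \<rho>) g"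
    and exp: "expectation (\<lambda>\<omega>. g (\<sigma> i \<omega>)) = measure_pmf.expectation (laplace_pmf lam \<rho>) g"
    for g :: "'a str \<Rightarrow> real" and i
    unfolding distr_sample[of i, symmetric] by (simp_all add: integrable_distr_eq integral_distr)
  show ?thesis
  proof (rule strong_law_exponential_moments[OF _ c])
    show "indep_vars (\<lambda>_. borel) (\<lambda>i \<omega>. f (\<sigma> i \<omega>)) {..<n}" for n
      by (rule indep_vars_compose2[OF indep_sample]) simp
    show "expectation (\<lambda>\<omega>. exp (c * \<bar>f (\<sigma> i \<omega>)\<bar>)) \<le>
        measure_pmf.expectation (laplace_pmf lam \<rho>) (\<lambda>s. exp (c * \<bar>f s\<bar>))" for i
      using exp[of "\<lambda>s. exp (c * \<bar>f s\<bar>)" i] by simp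
    show "integrable M (\<lambda>\<omega>. exp (c * \<bar>f (\<sigma> j \<omega>)\<bar>))" for j
      using int[of "\<lambda>s. exp (c * \<bar>f s\<bar>)" j] i by simp
    show "integrable M (\<lambda>\<omega>. f (\<sigma> i \<omega>))" for i
      using int laplace_integrable[OF lam \<rho> f] by simp
    show "expectation (\<lambda>\<omega>. f (\<sigma> i \<omega>)) = measure_pmf.expectation (laplace_pmf lam \<rho>) f" for i
      by (rule exp)
  qed
qed

end

section \<open>Which letters are most likely at a site\<close>

lemma pmf_laplace_eq_if_dist_eq:
  fixes l :: "('a::finite) str"
  assumes "l \<in> strings" "0 < r" "s \<in> strings" "t \<in> strings" "hamming_dist l s = hamming_dist l t"
  shows "pmf (laplace_pmf l r) s = pmf (laplace_pmf l r) t"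
  using assms by (simp add: pmf_laplace_pmf laplace_prob_def hamming_dist_commute[of _ l])

text \<open>A comparison of probabilities without any knowledge of the sizes of the spheres: the probability
  of a string depends on its distance from the centre alone, so an injection that keeps the distance
  also keeps probabilities.\<close>

lemma laplace_measure_compare:
  fixes l :: "('a::finite) str" and g :: "'a str \<Rightarrow> 'a str"
  assumes l: "l \<in> strings" and r: "0 < r"
    and inj: "inj_on g (A \<inter> strings)"
    and g: "\<And>s. s \<in> A \<Longrightarrow> s \<in> strings \<Longrightarrow>
      g s \<in> B \<and> g s \<in> strings \<and> hamming_dist l (g s) = hamming_dist l s"
  shows laplace_measure_le: "measure_pmf.prob (laplace_pmf l r) A \<le> measure_pmf.prob (laplace_pmf l r) B"
    and laplace_measure_less: "u \<in> B \<Longrightarrow> u \<in> strings \<Longrightarrow> u \<notin> g ` (A \<inter> strings) \<Longrightarrow>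
      measure_pmf.prob (laplace_pmf l r) A < measure_pmf.prob (laplace_pmf l r) B"
proof -
  let ?P = "laplace_pmf l r"
  have "measure_pmf.prob ?P A = measure_pmf.prob ?P (A \<inter> strings)"
    using measure_Int_set_pmf[of ?P A] by (simp add: set_laplace_pmf[OF l r])
  also have "\<dots> = infsetsum (\<lambda>s. pmf ?P (g s)) (A \<inter> strings)"
    unfolding measure_pmf_conv_infsetsum
    by (intro infsetsum_cong refl pmf_laplace_eq_if_dist_eq[OF l r]) (use g in auto)
  also have "\<dots> = measure_pmf.prob ?P (g ` (A \<inter> strings))"
    unfolding measure_pmf_conv_infsetsum by (rule infsetsum_reindex[OF inj, symmetric])
  finally have eq: "measure_pmf.prob ?P A = measure_pmf.prob ?P (g ` (A \<inter> strings))" .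
  have sub: "g ` (A \<inter> strings) \<subseteq> B" using g by auto
  show "measure_pmf.prob ?P A \<le> measure_pmf.prob ?P B"
    unfolding eq using sub by (intro measure_pmf.finite_measure_mono) auto
  assume u: "u \<in> B" "u \<in> strings" "u \<notin> g ` (A \<inter> strings)"
  have "0 < pmf ?P u" using u(2) by (intro pmf_positive) (simp add: set_laplace_pmf[OF l r])
  then have "measure_pmf.prob ?P A < measure_pmf.prob ?P (g ` (A \<inter> strings)) + measure_pmf.prob ?P {u}"
    unfolding eq by (simp add: measure_pmf_single)
  also have "\<dots> = measure_pmf.prob ?P (g ` (A \<inter> strings) \<union> {u})"
    using u(3) by (intro measure_pmf.finite_measure_Union[symmetric]) auto
  also have "\<dots> \<le> measure_pmf.prob ?P B"
    using sub u(1) by (intro measure_pmf.finite_measure_mono) auto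
  finally show "measure_pmf.prob ?P A < measure_pmf.prob ?P B" .
qed

text \<open>This is the injection that moves a string with a wrong letter at site \<open>j\<close> to one with the correct
  letter \<open>l j\<close> there, at the same distance from \<open>l\<close>: each agreement that is gained is paid for by one
  more letter at the end, beyond the length of \<open>l\<close>. If \<open>s\<close> is at least as long as \<open>l\<close>, one letter \<open>c'\<close>
  is appended. If \<open>s\<close> is shorter, its missing sites are filled from \<open>l\<close>, and as many letters \<open>c\<close> follow
  as there were missing sites, and one more if the wrong letter was not the empty one. The final letter
  tells the two cases apart and the length then determines the length of \<open>s\<close>, hence \<open>s\<close> itself.\<close>

definition repair_site :: "'a str \<Rightarrow> nat \<Rightarrow> 'a \<Rightarrow> 'a \<Rightarrow> 'a str \<Rightarrow> 'a str" where
  "repair_site l j c c' s =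
     (let L = str_length l; m = str_length s; e = 2 * L - m + (if s j = None then 0 else 1) in
      if L \<le> m then s(j := l j, m := Some c')
      else (\<lambda>i. if i = j then l j else if i < m then s i else if i < L then l i
                else if i < e then Some c else None))"

definition repaired_length :: "'a str \<Rightarrow> nat \<Rightarrow> 'a str \<Rightarrow> nat" where
  "repaired_length l j s =
     (let L = str_length l; m = str_length s in
      if L \<le> m then m + 1 else 2 * L - m + (if s j = None then 0 else 1))"

context
  fixes l s :: "'a str" and j :: nat and c c' :: 'a
  assumes l: "l \<in> strings" and s: "s \<in> strings" and j: "j < str_length l"
begin

lemma repair_site_None_iff: "repair_site l j c c' s i = None \<longleftrightarrow> repaired_length l j s \<le> i"
  using string_None_iff[OF l, of i] string_None_iff[OF s, of i] j
  by (auto simp: repair_site_def repaired_length_def Let_def)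

lemma repair_site_in_strings: "repair_site l j c c' s \<in> strings"
  by (rule stringI[OF repair_site_None_iff])

lemma str_length_repair_site: "str_length (repair_site l j c c' s) = repaired_length l j s"
  by (rule str_length_eqI[OF repair_site_None_iff])

lemma repaired_length_greater: "str_length l < repaired_length l j s"
  using j by (auto simp: repaired_length_def Let_def)

lemma repair_site_at: "repair_site l j c c' s j = l j"
  using j by (auto simp: repair_site_def Let_def)

lemma repair_site_last:
  "repair_site l j c c' s (repaired_length l j s - 1) =
     Some (if str_length l \<le> str_length s then c' else c)"
  using j by (auto simp: repair_site_def repaired_length_def Let_def)

lemma hamming_dist_repair_site:
  assumes x: "s j \<noteq> l j"
  shows "hamming_dist l (repair_site l j c c' s) = hamming_dist l s"
proof (cases "str_length l \<le> str_length s")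
  case True
  let ?m = "str_length s" and ?D = "{i. l i \<noteq> s i}"
  have m: "l ?m = None" "s ?m = None"
    using True by (simp_all add: string_None_iff[OF l] string_None_iff[OF s])
  have "{i. l i \<noteq> repair_site l j c c' s i} = insert ?m (?D - {j})"
    using True j m by (auto simp: repair_site_def Let_def)
  moreover have D: "?m \<notin> ?D" "j \<in> ?D" "finite ?D" using m x finite_differences[OF l s] by auto
  have "card ?D = Suc (card (?D - {j}))" using D(3,2) by (rule card.remove)
  moreover have "card (insert ?m (?D - {j})) = Suc (card (?D - {j}))" using D by simp
  ultimately show ?thesis unfolding hamming_dist_def by simp
next
  case False
  let ?L = "str_length l" and ?m = "str_length s" and ?E = "repaired_length l j s"
  let ?D = "{i. i < ?m \<and> l i \<noteq> s i}"
  have fin: "finite ?D" by simp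
  have "l i \<noteq> s i \<longleftrightarrow> i < ?m \<and> l i \<noteq> s i \<or> ?m \<le> i \<and> i < ?L" for i
    using False string_None_iff[OF l, of i] string_None_iff[OF s, of i] by (cases "l i"; cases "s i") auto
  then have "{i. l i \<noteq> s i} = ?D \<union> {?m..<?L}"
    unfolding set_eq_iff mem_Collect_eq Un_iff atLeastLessThan_iff by blast
  moreover have "card (?D \<union> {?m..<?L}) = card ?D + card {?m..<?L}"
    by (rule card_Un_disjoint) auto
  ultimately have 1: "hamming_dist l s = card ?D + (?L - ?m)"
    unfolding hamming_dist_def by simp
  have "l i \<noteq> repair_site l j c c' s i \<longleftrightarrow> i < ?m \<and> l i \<noteq> s i \<and> i \<noteq> j \<or> ?L \<le> i \<and> i < ?E" for i
    using False j string_None_iff[OF l, of i]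
    by (auto simp: repair_site_def repaired_length_def Let_def not_less)
  then have "{i. l i \<noteq> repair_site l j c c' s i} = (?D - {j}) \<union> {?L..<?E}"
    unfolding set_eq_iff mem_Collect_eq Un_iff Diff_iff singleton_iff atLeastLessThan_iff by blast
  moreover have "card ((?D - {j}) \<union> {?L..<?E}) = card (?D - {j}) + card {?L..<?E}"
    by (rule card_Un_disjoint) (use False in auto)
  ultimately have 2: "hamming_dist l (repair_site l j c c' s) = card (?D - {j}) + (?E - ?L)"
    unfolding hamming_dist_def by simp
  show ?thesis
  proof (cases "s j = None")
    case True
    then have "j \<notin> ?D" using string_None_iff[OF s, of j] by auto
    then have "card (?D - {j}) = card ?D" by simp
    then show ?thesis using False True unfolding 1 2 by (simp add: repaired_length_def Let_def)
  next
    case sj: False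
    then have "j \<in> ?D" using string_None_iff[OF s, of j] x by (auto simp: not_le)
    then have "card ?D = Suc (card (?D - {j}))" using fin by (rule card.remove[rotated])
    then show ?thesis using False sj unfolding 1 2 by (simp add: repaired_length_def Let_def)
  qed
qed

end

text \<open>The letter \<open>x\<close> at site \<open>j\<close> must be fixed, since it is the one thing that the repaired string
  does not show.\<close>

lemma inj_on_repair_site:
  assumes l: "l \<in> strings" and j: "j < str_length l" and c: "c \<noteq> c'"
  shows "inj_on (repair_site l j c c') ({s. s j = x} \<inter> strings)"
proof (rule inj_onI)
  fix s t assume s: "s \<in> {s. s j = x} \<inter> strings" and t: "t \<in> {s. s j = x} \<inter> strings"
    and eq: "repair_site l j c c' s = repair_site l j c c' t"
  let ?L = "str_length l"
  have E: "repaired_length l j s = repaired_length l j t"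
    using str_length_repair_site[OF l _ j, of s c c'] str_length_repair_site[OF l _ j, of t c c'] s t eq
    by simp
  have "?L \<le> str_length s \<longleftrightarrow> ?L \<le> str_length t"
    using repair_site_last[OF l _ j, of s c c'] repair_site_last[OF l _ j, of t c c'] s t eq E c
    by (auto split: if_splits)
  moreover from this have len: "str_length s = str_length t"
    using E s t by (auto simp: repaired_length_def Let_def split: if_splits)
  ultimately show "s = t"
  proof (intro ext)
    fix i
    assume *: "?L \<le> str_length s \<longleftrightarrow> ?L \<le> str_length t" "str_length s = str_length t"
    consider "i = j" | "i \<ge> str_length s" | "i \<noteq> j" "i < str_length s" by linarith
    then show "s i = t i"
    proof cases
      case 2
      then have "s i = None" "t i = None"
        using s t *(2) string_None_iff[of s i] string_None_iff[of t i] by auto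
      then show ?thesis by simp
    next
      case 3
      then show ?thesis using fun_cong[OF eq, of i] *
        by (simp add: repair_site_def Let_def split: if_splits)
    qed (use s t in auto)
  qed
qed

text \<open>Repairing site \<open>j\<close> shows \<open>\<le>\<close>. The inequality is strict because repaired strings are longer than
  \<open>l\<close>, so that \<open>l\<close> itself is missed. Two letters are needed to mark the two cases of the repair.\<close>

lemma laplace_modal_letter:
  fixes l :: "('a::finite) str"
  assumes card: "2 \<le> CARD('a)" and l: "l \<in> strings" and r: "0 < r"
    and j: "j < str_length l" and x: "x \<noteq> l j"
  shows "measure_pmf.prob (laplace_pmf l r) {s. s j = x} < measure_pmf.prob (laplace_pmf l r) {s. s j = l j}"
proof -
  obtain c c' :: 'a where c: "c \<noteq> c'"
    using card card_le_Suc0_iff_eq[of "UNIV :: 'a set"] by fastforce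
  show ?thesis
  proof (rule laplace_measure_less[OF l r inj_on_repair_site[OF l j c]])
    fix s assume "s \<in> {s. s j = x}" and s: "s \<in> strings"
    then show "repair_site l j c c' s \<in> {s. s j = l j} \<and> repair_site l j c c' s \<in> strings \<and>
        hamming_dist l (repair_site l j c c' s) = hamming_dist l s"
      using repair_site_at[OF l s j] repair_site_in_strings[OF l s j] hamming_dist_repair_site[OF l s j] x
      by simp
  next
    show "l \<notin> repair_site l j c c' ` ({s. s j = x} \<inter> strings)"
    proof
      assume "l \<in> repair_site l j c c' ` ({s. s j = x} \<inter> strings)"
      then obtain s where s: "s \<in> strings" "l = repair_site l j c c' s" by auto
      then show False
        using str_length_repair_site[OF l s(1) j, of c c'] repaired_length_greater[OF l s(1) j] by simp
    qed
  qed (use l in auto)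
qed

text \<open>Beyond the end of \<open>l\<close> every letter is equally wrong, so exchanging letters keeps the distance.
  The empty letter may still be less likely than a letter at such sites. This is why the consensus
  sequence has to be truncated where the letter frequencies become nearly equal.\<close>

lemma laplace_uniform_letters:
  fixes l :: "('a::finite) str"
  assumes l: "l \<in> strings" and r: "0 < r" and j: "str_length l \<le> j"
  shows "measure_pmf.prob (laplace_pmf l r) {s. s j = Some a} = measure_pmf.prob (laplace_pmf l r) {s. s j = Some b}"
proof -
  have lj: "l j = None" using string_None_iff[OF l] j by simp
  have "measure_pmf.prob (laplace_pmf l r) {s. s j = Some a} \<le> measure_pmf.prob (laplace_pmf l r) {s. s j = Some b}"
    for a b
  proof (rule laplace_measure_le[OF l r, where g = "\<lambda>s. s(j := Some b)"])
    show "inj_on (\<lambda>s. s(j := Some b)) ({s. s j = Some a} \<inter> strings)"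
    proof (rule inj_onI)
      fix s t assume "s \<in> {s. s j = Some a} \<inter> strings" "t \<in> {s. s j = Some a} \<inter> strings"
        and eq: "s(j := Some b) = t(j := Some b)"
      then have "s j = t j" by simp
      then show "s = t" using eq by (metis fun_upd_triv fun_upd_upd)
    qed
    fix s :: "'a str" assume sj: "s \<in> {s. s j = Some a}" and s: "s \<in> strings"
    have "(s(j := Some b)) i = None \<longleftrightarrow> str_length s \<le> i" for i
      using string_None_iff[OF s, of i] sj by auto
    then have "s(j := Some b) \<in> strings" by (rule stringI)
    moreover have "{i. l i \<noteq> (s(j := Some b)) i} = {i. l i \<noteq> s i}" using lj sj by auto
    ultimately show "s(j := Some b) \<in> {s. s j = Some b} \<and> s(j := Some b) \<in> strings \<and>
        hamming_dist l (s(j := Some b)) = hamming_dist l s"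
      by (simp add: hamming_dist_def)
  qed
  then show ?thesis by (intro antisym)
qed

text \<open>Every string ends, so the probability that site \<open>J\<close> carries a letter tends to 0. Once it is below
  \<open>1 / 2\<close>, the empty letter beats each single letter.\<close>

lemma laplace_empty_letter_eventually:
  fixes l :: "('a::finite) str"
  assumes l: "l \<in> strings" and r: "0 < r"
  obtains J where "str_length l \<le> J" "\<And>a. measure_pmf.prob (laplace_pmf l r) {s. s J = Some a}
    < measure_pmf.prob (laplace_pmf l r) {s. s J = None}"
proof -
  let ?P = "laplace_pmf l r"
  define N where "N j = {s \<in> strings. s j \<noteq> (None :: 'a option)}" for j
  have dec: "decseq N"
    unfolding N_def decseq_Suc_iff strings_def by auto
  have "\<exists>j. s \<notin> N j" for s
    unfolding N_def using string_None_iff[of s "str_length s"] by blast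
  then have "(\<Inter>j. N j) = {}" by blast
  then have "(\<lambda>j. measure_pmf.prob ?P (N j)) \<longlonglongrightarrow> 0"
    using measure_pmf.finite_Lim_measure_decseq[of N ?P, OF _ dec] by simp
  then have "\<forall>\<^sub>F j in sequentially. measure_pmf.prob ?P (N j) < 1 / 2"
    by (rule order_tendstoD) simp
  then have "\<forall>\<^sub>F j in sequentially. str_length l \<le> j \<and> measure_pmf.prob ?P (N j) < 1 / 2"
    using eventually_ge_at_top[of "str_length l"] by eventually_elim simp
  then obtain J where J: "str_length l \<le> J" "measure_pmf.prob ?P (N J) < 1 / 2"
    using eventually_happens[of _ sequentially] by auto
  have N: "measure_pmf.prob ?P {s. s J \<noteq> None} = measure_pmf.prob ?P (N J)"
    using measure_Int_set_pmf[of ?P "{s. s J \<noteq> None}"]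
    by (simp add: set_laplace_pmf[OF l r] N_def Int_def conj_commute)
  have "measure_pmf.prob ?P {s. s J = None} = 1 - measure_pmf.prob ?P {s. s J \<noteq> None}"
    using measure_pmf.prob_compl[of "{s. s J \<noteq> None}" ?P] by (simp add: set_diff_eq)
  then have "1 / 2 < measure_pmf.prob ?P {s. s J = None}" using J(2) N by simp
  moreover have "measure_pmf.prob ?P {s. s J = Some a} \<le> measure_pmf.prob ?P (N J)" for a
    unfolding N[symmetric] by (intro measure_pmf.finite_measure_mono) auto
  ultimately have "measure_pmf.prob ?P {s. s J = Some a} < measure_pmf.prob ?P {s. s J = None}" for a
    using J(2) by (meson le_less_trans less_trans)
  with J(1) show thesis by (rule that)
qed

section \<open>The truncated consensus sequence finds the centre\<close>

lemma Max_range_eqI: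
  fixes f :: "'b::finite \<Rightarrow> real"
  shows "(\<And>x. f x \<le> f y) \<Longrightarrow> Max (range f) = f y"
  by (intro Max_eqI) auto

lemma letter_spread_less_iff:
  "letter_spread ss j < e \<longleftrightarrow> (\<forall>a b. rel_freq ss j (Some a) - rel_freq ss j (Some b) < e)"
proof -
  let ?f = "\<lambda>a. rel_freq ss j (Some a)"
  have "Max (range ?f) \<in> range ?f" "Min (range ?f) \<in> range ?f" by (auto intro: Max_in Min_in)
  then obtain a b where ab: "Max (range ?f) = ?f a" "Min (range ?f) = ?f b" by (meson rangeE)
  have "?f x \<le> ?f a" "?f b \<le> ?f x" for x
    unfolding ab[symmetric] by (auto intro: Max_ge Min_le)
  then show ?thesis unfolding letter_spread_def ab by (smt (verit, best))
qed

text \<open>The consensus length may be any \<open>K\<close> between the length of \<open>l\<close> and \<open>J\<close>, and may vary with the sample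
  if the letters and the empty letter are equally likely somewhere. The result is \<open>l\<close> in each case: for
  larger \<open>K\<close> the sites from the length of \<open>l\<close> on are exactly the ones that are cut off as nearly uniform,
  and for \<open>K\<close> equal to the length there is nothing to cut off.\<close>

lemma truncated_consensus_eqI:
  fixes ss :: "('a::finite) str list"
  assumes l: "l \<in> strings" and modal: "modal_letters ss \<eta>"
    and strict: "\<And>j x. j < str_length l \<Longrightarrow> x \<noteq> l j \<Longrightarrow> rel_freq ss j x < rel_freq ss j (l j)"
    and spread: "\<And>j. j < str_length l \<Longrightarrow> \<epsilon> \<le> letter_spread ss j"
    and J: "str_length l \<le> J" "\<And>x. rel_freq ss J x \<le> rel_freq ss J None"
    and uniform: "\<And>j. str_length l \<le> j \<Longrightarrow> j < J \<Longrightarrow> letter_spread ss j < \<epsilon>"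
  shows "truncated_consensus \<epsilon> ss \<eta> = l"
proof -
  let ?L = "str_length l" and ?K = "consensus_length ss"
  have MJ: "Max (range (rel_freq ss J)) = rel_freq ss J None"
    by (rule Max_range_eqI) (rule J(2))
  have KJ: "?K \<le> J"
    unfolding consensus_length_def by (rule Least_le) (simp add: MJ)
  have "rel_freq ss ?K None = Max (range (rel_freq ss ?K))"
    unfolding consensus_length_def
    by (rule LeastI[of _ J]) (simp add: MJ)
  then have "rel_freq ss ?K x \<le> rel_freq ss ?K None" for x by (auto intro: Max_ge)
  then have LK: "?L \<le> ?K"
    using strict[of ?K None] string_None_iff[OF l, of ?K] by (metis leI not_less)
  have prefix: "str_prefix ?L \<eta> = l"
  proof
    fix j
    show "str_prefix ?L \<eta> j = l j"
    proof (cases "j < ?L")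
      case True
      have "rel_freq ss j (l j) \<le> rel_freq ss j (\<eta> j)"
        using modal by (auto simp: modal_letters_def is_arg_max_linorder)
      then have "\<eta> j = l j" using strict[OF True, of "\<eta> j"] by fastforce
      then show ?thesis using True by (simp add: str_prefix_def)
    next
      case False
      then show ?thesis using string_None_iff[OF l, of j] by (simp add: str_prefix_def)
    qed
  qed
  have empty: "empty_str = l" if "?L = 0"
    using prefix that by (auto simp: str_prefix_def empty_str_def)
  have uf: "uniform_from \<epsilon> ss j \<longleftrightarrow> ?L \<le> j \<and> j < ?K" for j
  proof
    show "uniform_from \<epsilon> ss j \<Longrightarrow> ?L \<le> j \<and> j < ?K"
      using spread[of j] unfolding uniform_from_def by (metis le_refl not_le)
    show "?L \<le> j \<and> j < ?K \<Longrightarrow> uniform_from \<epsilon> ss j"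
      using uniform KJ unfolding uniform_from_def by (meson le_trans less_le_trans)
  qed
  have tail: "uniform_tail \<epsilon> ss \<longleftrightarrow> ?L < ?K"
    unfolding uniform_tail_def uf by (meson le_less_trans le_refl)
  have start: "uniform_start \<epsilon> ss = ?L" if "?L < ?K"
    unfolding uniform_start_def uf using that by (intro Least_equality) auto
  show ?thesis
  proof (cases "?L < ?K")
    case True
    then show ?thesis using tail start[OF True] prefix empty by (simp add: truncated_consensus_def)
  next
    case False
    then have "?K = ?L" using LK by simp
    then show ?thesis using tail prefix empty by (simp add: truncated_consensus_def)
  qed
qed

lemma rel_freq_eq_sum:
  "rel_freq (map f [0..<n]) j x = (\<Sum>i<n. indicator {s. s j = x} (f i)) / real n"
proof -
  have "{i. i < n \<and> f i j = x} = {i \<in> {..<n}. f i \<in> {s. s j = x}}" by auto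
  moreover have "(\<Sum>i<n. indicator {s. s j = x} (f i)) = real (card {i \<in> {..<n}. f i \<in> {s. s j = x}})"
    by (simp add: sum_indicator_eq_card Int_def indicator_def sum.If_cases)
  moreover have "{i. i < length (map f [0..<n]) \<and> (map f [0..<n] ! i) j = x} = {i. i < n \<and> f i j = x}"
    by (intro Collect_cong) auto
  ultimately show ?thesis by (simp add: rel_freq_def)
qed

text \<open>Only finitely many strict inequalities between limits of frequencies are involved: those at the
  sites of \<open>l\<close>, and those at the sites up to some \<open>J\<close> at which the empty letter dominates. They
  eventually hold for the frequencies themselves. The bound \<open>\<epsilon>\<^sub>0\<close> depends on \<open>l\<close> and \<open>r\<close> only.\<close>

lemma eventually_truncated_consensus:
  fixes l :: "('a::finite) str"
  assumes card: "2 \<le> CARD('a)" and l: "l \<in> strings" and r: "0 < r"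
  obtains \<epsilon>\<^sub>0 where "0 < \<epsilon>\<^sub>0" "\<And>ss \<epsilon>.
    (\<And>j x. (\<lambda>n. rel_freq (ss n) j x) \<longlonglongrightarrow> measure_pmf.prob (laplace_pmf l r) {s. s j = x}) \<Longrightarrow>
    0 < \<epsilon> \<Longrightarrow> \<epsilon> \<le> \<epsilon>\<^sub>0 \<Longrightarrow>
    \<forall>\<^sub>F n in sequentially. \<forall>\<eta>. modal_letters (ss n) \<eta> \<longrightarrow> truncated_consensus \<epsilon> (ss n) \<eta> = l"
proof -
  let ?L = "str_length l"
  define p where "p j x = measure_pmf.prob (laplace_pmf l r) {s. s j = x}" for j x
  have modal: "p j x < p j (l j)" if "j < ?L" "x \<noteq> l j" for j x
    unfolding p_def by (rule laplace_modal_letter[OF card l r that])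
  obtain a\<^sub>1 a\<^sub>2 :: 'a where "a\<^sub>1 \<noteq> a\<^sub>2"
    using card card_le_Suc0_iff_eq[of "UNIV :: 'a set"] by fastforce
  then have "\<exists>b. Some b \<noteq> l j" for j by (metis option.inject)
  then obtain b where b: "\<And>j. Some (b j) \<noteq> l j" by metis
  \<comment> \<open>Half of the smallest gap between the correct letter and the wrong letter \<open>b j\<close> at the
    sites of \<open>l\<close>; the \<open>1\<close> only serves the empty string \<open>l\<close>, which has no sites.\<close>
  define \<epsilon>\<^sub>0 where "\<epsilon>\<^sub>0 = Min (insert 1 ((\<lambda>j. (p j (l j) - p j (Some (b j))) / 2) ` {..<?L}))"
  have \<epsilon>\<^sub>0: "0 < \<epsilon>\<^sub>0" using modal[OF _ b] by (auto simp: \<epsilon>\<^sub>0_def)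
  have \<epsilon>\<^sub>0_less: "\<epsilon>\<^sub>0 < p j (l j) - p j (Some (b j))" if "j < ?L" for j
  proof -
    have "\<epsilon>\<^sub>0 \<le> (p j (l j) - p j (Some (b j))) / 2"
      unfolding \<epsilon>\<^sub>0_def using that by (intro Min_le) auto
    then show ?thesis using modal[OF that b] by (auto simp: field_simps)
  qed
  obtain J where J: "?L \<le> J" "\<And>a. p J (Some a) < p J None"
    using laplace_empty_letter_eventually[OF l r] unfolding p_def by blast
  show thesis
  proof (rule that[OF \<epsilon>\<^sub>0])
    fix ss :: "nat \<Rightarrow> 'a str list" and \<epsilon> :: real
    assume lim: "(\<lambda>n. rel_freq (ss n) j x) \<longlonglongrightarrow> measure_pmf.prob (laplace_pmf l r) {s. s j = x}" for j x
    assume \<epsilon>: "0 < \<epsilon>" "\<epsilon> \<le> \<epsilon>\<^sub>0"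
    note lim = lim[folded p_def]
    have ev: "\<forall>\<^sub>F n in sequentially. e < rel_freq (ss n) j x - rel_freq (ss n) j y"
      if "e < p j x - p j y" for e j x y
      by (rule order_tendstoD(1)[OF tendsto_diff[OF lim lim] that])
    have "\<forall>\<^sub>F n in sequentially. \<forall>j\<in>{..<?L}. \<forall>x\<in>UNIV - {l j}. 0 < rel_freq (ss n) j (l j) - rel_freq (ss n) j x"
      by (intro eventually_ball_finite ballI ev) (use modal in auto)
    moreover have "\<forall>\<^sub>F n in sequentially. \<forall>j\<in>{..<?L}. \<epsilon>\<^sub>0 < rel_freq (ss n) j (l j) - rel_freq (ss n) j (Some (b j))"
      by (intro eventually_ball_finite ballI ev) (use \<epsilon>\<^sub>0_less in auto)
    moreover have "\<forall>\<^sub>F n in sequentially. \<forall>a\<in>UNIV. 0 < rel_freq (ss n) J None - rel_freq (ss n) J (Some a)"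
      by (intro eventually_ball_finite ballI ev) (use J in auto)
    moreover have "\<forall>\<^sub>F n in sequentially. \<forall>j\<in>{?L..<J}. \<forall>a\<in>UNIV. \<forall>b\<in>UNIV.
        - \<epsilon> < rel_freq (ss n) j (Some a) - rel_freq (ss n) j (Some b)"
    proof (intro eventually_ball_finite ballI ev)
      fix j a b assume "j \<in> {?L..<J}"
      then have "p j (Some a) = p j (Some b)"
        unfolding p_def by (intro laplace_uniform_letters[OF l r]) simp
      then show "- \<epsilon> < p j (Some a) - p j (Some b)" using \<epsilon> by simp
    qed auto
    ultimately show "\<forall>\<^sub>F n in sequentially. \<forall>\<eta>. modal_letters (ss n) \<eta> \<longrightarrow> truncated_consensus \<epsilon> (ss n) \<eta> = l"
    proof eventually_elim
      case (elim n)
      show ?case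
      proof (intro allI impI truncated_consensus_eqI[OF l _ _ _ J(1)])
        fix j x assume "j < ?L" "x \<noteq> l j"
        then show "rel_freq (ss n) j x < rel_freq (ss n) j (l j)" using elim(1) by simp
      next
        fix j assume j: "j < ?L"
        then obtain a where "l j = Some a" using string_None_iff[OF l, of j] by fastforce
        then have gap: "\<epsilon> < rel_freq (ss n) j (Some a) - rel_freq (ss n) j (Some (b j))"
          using elim(2) j \<epsilon>(2) by (metis lessThan_iff le_less_trans)
        show "\<epsilon> \<le> letter_spread (ss n) j"
        proof (rule ccontr)
          assume "\<not> \<epsilon> \<le> letter_spread (ss n) j"
          then have "rel_freq (ss n) j (Some a) - rel_freq (ss n) j (Some (b j)) < \<epsilon>"
            using letter_spread_less_iff[of "ss n" j \<epsilon>] by (simp add: not_le)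
          with gap show False by simp
        qed
      next
        fix x show "rel_freq (ss n) J x \<le> rel_freq (ss n) J None"
          using elim(3) by (cases x) (auto simp: less_imp_le)
      next
        fix j assume "?L \<le> j" "j < J"
        then show "letter_spread (ss n) j < \<epsilon>"
          using elim(4) unfolding letter_spread_less_iff by (auto simp: algebra_simps)
      qed
    qed
  qed
qed

section \<open>Maximum likelihood\<close>

text \<open>The Kullback-Leibler divergence of distinct distributions is positive. With \<open>g = Q / P\<close> on the
  support of \<open>P\<close>, integrate \<open>ln g \<le> g - 1\<close>: the right side has expectation at most 0, and equality
  forces \<open>g = 1\<close> on the support.\<close>

lemma gibbs_inequality_pmf:
  fixes P Q :: "'s pmf"
  assumes supp: "set_pmf P \<subseteq> set_pmf Q" and neq: "P \<noteq> Q"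
    and intP: "integrable P (\<lambda>s. ln (pmf P s))" and intQ: "integrable P (\<lambda>s. ln (pmf Q s))"
  shows "measure_pmf.expectation P (\<lambda>s. ln (pmf Q s)) < measure_pmf.expectation P (\<lambda>s. ln (pmf P s))"
proof (rule ccontr)
  assume le: "\<not> ?thesis"
  define g where "g s = pmf Q s / pmf P s" for s
  have pos: "0 < pmf P s" "0 < pmf Q s" "0 < g s" "ln (g s) = ln (pmf Q s) - ln (pmf P s)"
    if "s \<in> set_pmf P" for s
    using that supp by (auto simp: g_def pmf_positive ln_div subset_iff set_pmf_iff)
  have "(\<integral>\<^sup>+s. ennreal (g s) \<partial>measure_pmf P) = (\<integral>\<^sup>+s. ennreal (pmf P s * g s) \<partial>count_space UNIV)"
    unfolding nn_integral_measure_pmf by (intro nn_integral_cong) (simp add: ennreal_mult[symmetric] g_def)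
  also have "\<dots> \<le> (\<integral>\<^sup>+s. ennreal (pmf Q s) \<partial>count_space UNIV)"
    by (intro nn_integral_mono ennreal_leI) (simp add: g_def)
  also have "\<dots> = 1" using nn_integral_pmf[of UNIV Q] by simp
  finally have nn: "(\<integral>\<^sup>+s. ennreal (g s) \<partial>measure_pmf P) \<le> 1" .
  have g0: "0 \<le> g s" for s by (simp add: g_def)
  have intg: "integrable P g"
    using nn g0 by (intro integrableI_nonneg) (auto intro: le_less_trans)
  have Eg: "measure_pmf.expectation P g \<le> 1"
    using nn nn_integral_eq_integral[OF intg] g0 by (simp add: ennreal_le_1)
  define h where "h s = g s - 1 - (ln (pmf Q s) - ln (pmf P s))" for s
  have inth: "integrable P h" unfolding h_def using intg intP intQ by auto
  have h0: "AE s in P. 0 \<le> h s"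
    unfolding AE_measure_pmf_iff h_def using pos(3,4) ln_le_minus_one by (metis diff_ge_0_iff_ge)
  have "measure_pmf.expectation P h \<le> 0"
    unfolding h_def using intg intP intQ Eg le by simp
  then have "measure_pmf.expectation P h = 0"
    using integral_nonneg_AE[OF h0] by simp
  then have "AE s in P. h s = 0"
    using integral_nonneg_eq_0_iff_AE[OF inth h0] by simp
  then have eq: "pmf Q s = pmf P s" if "s \<in> set_pmf P" for s
    using that pos[OF that] ln_eq_minus_one[of "g s"] unfolding AE_measure_pmf_iff h_def
    by (auto simp: g_def)
  \<comment> \<open>Two probability mass functions that agree on the support of one of them are equal.\<close>
  have "Q = P"
  proof (rule pmf_eqI)
    fix s
    show "pmf Q s = pmf P s"
    proof (cases "s \<in> set_pmf P")
      case False
      have "measure_pmf.prob Q (set_pmf P) = infsetsum (pmf P) (set_pmf P)"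
        unfolding measure_pmf_conv_infsetsum by (rule infsetsum_cong) (auto simp: eq)
      also have "\<dots> = 1"
        unfolding measure_pmf_conv_infsetsum[symmetric] by (simp add: measure_pmf.prob_eq_1 AE_measure_pmf)
      finally have "AE t in Q. t \<in> set_pmf P" by (simp add: measure_pmf.prob_eq_1)
      then have "s \<notin> set_pmf Q" using False by (auto simp: AE_measure_pmf_iff)
      with False show ?thesis by (simp add: set_pmf_iff)
    qed (rule eq)
  qed
  with neq show False by simp
qed

text \<open>For a sample with mean distance \<open>D\<close> from a given centre, this is the part of the mean
  log-likelihood at dispersion \<open>r\<close> that depends on \<open>r\<close>. The rest is minus the mean of \<open>log_sphere\<close>.\<close>

definition log_profile :: "real \<Rightarrow> real \<Rightarrow> real" where
  "log_profile D r = D * ln r - (D + 1) * ln (r + 1)"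

definition log_sphere :: "'a str \<Rightarrow> 'a str \<Rightarrow> real" where
  "log_sphere l s = ln (real (card (str_sphere hamming_dist l (hamming_dist l s))))"

text \<open>The difference of the two sides is \<open>D ln u + ln v\<close> for the quotients \<open>u\<close> and \<open>v\<close> below, whose
  tangent bound \<open>D (u - 1) + (v - 1)\<close> is zero.\<close>

lemma log_profile_less:
  assumes D: "0 < D" and r: "0 < r" and neq: "r \<noteq> D"
  shows "log_profile D r < log_profile D D"
proof -
  define u v where "u = r * (D + 1) / (D * (r + 1))" and "v = (D + 1) / (r + 1)"
  have uv: "0 < u" "0 < v" using D r by (auto simp: u_def v_def)
  have "v \<noteq> 1" using D r neq by (simp add: v_def)
  then have "ln v < v - 1" using uv ln_le_minus_one[of v] ln_eq_minus_one[of v] by fastforce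
  moreover have "D * ln u \<le> D * (u - 1)"
    using D uv by (intro mult_left_mono ln_le_minus_one) auto
  moreover have "D * (u - 1) + (v - 1) = 0"
  proof -
    have "u - 1 = (r - D) / (D * (r + 1))" "v - 1 = (D - r) / (r + 1)"
      using D r by (simp_all add: u_def v_def divide_simps) (simp add: algebra_simps)
    then show ?thesis using D by (simp add: add_divide_distrib[symmetric])
  qed
  moreover have uv_ln: "ln u = ln r + ln (D + 1) - (ln D + ln (r + 1))" "ln v = ln (D + 1) - ln (r + 1)"
    using D r by (simp_all add: u_def v_def ln_div ln_mult)
  have "log_profile D r - log_profile D D = D * ln u + ln v"
    unfolding log_profile_def uv_ln by (simp add: algebra_simps)
  ultimately show ?thesis by linarith
qed

lemma log_profile_le:
  assumes "0 < D" "0 < r"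
  shows "log_profile D r \<le> log_profile D D"
  using log_profile_less[OF assms] by (cases "r = D") auto

text \<open>A bound on the likelihood of one observation that is uniform in the dispersion and tends to
  minus infinity with the distance. It rules out distant centres all at once.\<close>

lemma log_profile_le_neg_ln:
  fixes d :: nat
  assumes r: "0 < r"
  shows "log_profile (real d) r \<le> - ln (real d + 1)"
proof (cases "d = 0")
  case True
  then show ?thesis using r by (simp add: log_profile_def)
next
  case False
  then have "log_profile (real d) r \<le> log_profile (real d) (real d)"
    using r by (intro log_profile_le) auto
  also have "real d * ln (real d) \<le> real d * ln (real d + 1)"
    using False by (intro mult_left_mono) auto
  then have "log_profile (real d) (real d) \<le> - ln (real d + 1)"
    by (simp add: log_profile_def algebra_simps)
  finally show ?thesis .
qed

lemma log_sphere_nonneg: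
  "l \<in> strings \<Longrightarrow> 0 \<le> log_sphere l s" for l :: "('a::finite) str"
  using card_str_sphere_pos[of l "hamming_dist l s"] by (simp add: log_sphere_def)

lemma ln_laplace_prob:
  fixes l :: "('a::finite) str"
  assumes "l \<in> strings" "0 < r"
  shows "ln (laplace_prob hamming_dist l r s) = log_profile (real (hamming_dist l s)) r - log_sphere l s"
    and laplace_prob_pos: "0 < laplace_prob hamming_dist l r s"
proof -
  let ?d = "hamming_dist l s"
  define c where "c = real (card (str_sphere hamming_dist l ?d))"
  have c: "0 < c" using card_str_sphere_pos[OF assms(1)] by (simp add: c_def)
  have prob: "laplace_prob hamming_dist l r s = 1 / ((r + 1) * c) * (r / (r + 1)) ^ ?d"
    by (simp add: laplace_prob_def c_def hamming_dist_commute[of s l])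
  show "0 < laplace_prob hamming_dist l r s"
    unfolding prob using assms(2) c by (intro mult_pos_pos divide_pos_pos zero_less_power) auto
  have "ln (laplace_prob hamming_dist l r s) = ln (1 / ((r + 1) * c)) + ln ((r / (r + 1)) ^ ?d)"
    unfolding prob using assms(2) c by (intro ln_mult_pos) auto
  also have "ln (1 / ((r + 1) * c)) = - (ln (r + 1) + ln c)"
    using assms(2) c by (simp add: ln_div ln_mult_pos del: mult_eq_0_iff)
  also have "ln ((r / (r + 1)) ^ ?d) = real ?d * (ln r - ln (r + 1))"
    using assms(2) by (simp add: ln_realpow ln_div)
  finally show "ln (laplace_prob hamming_dist l r s) = log_profile (real ?d) r - log_sphere l s"
    by (simp add: log_profile_def log_sphere_def c_def algebra_simps)
qed

lemma hamming_dist_linear_bound: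
  assumes "l \<in> strings" "m \<in> strings" "s \<in> strings"
  shows "\<bar>real (hamming_dist l s)\<bar> \<le> real (hamming_dist l m) + 1 * real (hamming_dist m s)"
  using hamming_dist_triangle[OF assms] by simp

lemma log_sphere_linear_bound:
  fixes l :: "('a::finite) str"
  assumes l: "l \<in> strings" and m: "m \<in> strings" and s: "s \<in> strings"
  shows "\<bar>log_sphere l s\<bar> \<le> real (str_length l + hamming_dist l m) * ln (real (CARD('a) + 1)) +
    ln (real (CARD('a) + 1)) * real (hamming_dist m s)"
proof -
  let ?k = "real (CARD('a) + 1)" and ?c = "card (str_sphere hamming_dist l (hamming_dist l s))"
  have pos: "0 < ?c" by (rule card_str_sphere_pos[OF l])
  have "real ?c \<le> real ((CARD('a) + 1) ^ (str_length l + hamming_dist l s))"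
    using card_str_sphere_le[OF l] by (rule of_nat_mono)
  then have "ln (real ?c) \<le> ln (?k ^ (str_length l + hamming_dist l s))"
    using pos by (subst ln_le_cancel_iff) (simp_all add: of_nat_power)
  also have "\<dots> = real (str_length l + hamming_dist l s) * ln ?k" by (simp add: ln_realpow)
  also have "\<dots> \<le> real (str_length l + hamming_dist l m + hamming_dist m s) * ln ?k"
    using hamming_dist_triangle[OF l m s] by (intro mult_right_mono) auto
  finally show ?thesis
    using log_sphere_nonneg[OF l, of s] by (simp add: log_sphere_def algebra_simps)
qed

definition mean_dist :: "('a::finite) str \<Rightarrow> real \<Rightarrow> 'a str \<Rightarrow> real" where
  "mean_dist m r l = measure_pmf.expectation (laplace_pmf m r) (\<lambda>s. real (hamming_dist l s))"

definition mean_log_sphere :: "('a::finite) str \<Rightarrow> real \<Rightarrow> 'a str \<Rightarrow> real" where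
  "mean_log_sphere m r l = measure_pmf.expectation (laplace_pmf m r) (log_sphere l)"

context
  fixes m :: "('a::finite) str" and r :: real
  assumes m: "m \<in> strings" and r: "0 < r"
begin

text \<open>The centre is identifiable, being the unique mode: it has probability \<open>1 / (p + 1)\<close>, and every
  other string less. If \<open>l\<close> and \<open>m\<close> were different centres of the same distribution, each of the two
  would be more likely than the other.\<close>

lemma laplace_pmf_inject:
  assumes l: "l \<in> strings" and r': "0 < r'" and eq: "laplace_pmf l r' = laplace_pmf m r"
  shows "l = m"
proof (rule ccontr)
  assume neq: "l \<noteq> m"
  have center: "pmf (laplace_pmf t p) t = 1 / (p + 1)" if "t \<in> strings" "0 < p" for t :: "'a str" and p
    using that by (simp add: pmf_laplace_pmf laplace_prob_def str_sphere_center)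
  have off: "pmf (laplace_pmf t p) s < 1 / (p + 1)"
    if t: "t \<in> strings" and p: "0 < p" and s: "s \<in> strings" and st: "s \<noteq> t" for s t :: "'a str" and p
  proof -
    let ?d = "hamming_dist s t"
    have d: "0 < ?d" using hamming_dist_eq_0_iff[OF s t] st by simp
    have c: "0 < card (str_sphere hamming_dist t ?d)" by (rule card_str_sphere_pos[OF t])
    then have "1 \<le> real (card (str_sphere hamming_dist t ?d))" by linarith
    then have "1 / ((p + 1) * real (card (str_sphere hamming_dist t ?d))) \<le> 1 / (p + 1)"
      using p by (intro divide_left_mono) (auto simp: mult_le_cancel_left1)
    moreover have "(p / (p + 1)) ^ ?d < 1"
      using p d power_Suc_less_one[of "p / (p + 1)" "?d - 1"] by simp
    ultimately have "1 / ((p + 1) * real (card (str_sphere hamming_dist t ?d))) * (p / (p + 1)) ^ ?d < 1 / (p + 1) * 1"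
      using p c by (intro mult_le_less_imp_less) auto
    then show ?thesis using pmf_laplace_pmf[OF t p s] by (simp add: laplace_prob_def)
  qed
  show False
    using center[OF l r'] center[OF m r] off[OF l r' m] off[OF m r l] neq eq by simp
qed

lemma integrable_dist: "l \<in> strings \<Longrightarrow> integrable (laplace_pmf m r) (\<lambda>s. real (hamming_dist l s))"
  using hamming_dist_linear_bound[OF _ m] by (intro laplace_integrable[OF m r])

lemma integrable_log_sphere: "l \<in> strings \<Longrightarrow> integrable (laplace_pmf m r) (log_sphere l)"
  using log_sphere_linear_bound[OF _ m] by (intro laplace_integrable[OF m r])

lemma mean_dist_pos:
  assumes l: "l \<in> strings"
  shows "0 < mean_dist m r l"
proof -
  have "mean_dist m r l \<noteq> 0"
  proof
    assume "mean_dist m r l = 0"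
    then have "AE s in laplace_pmf m r. real (hamming_dist l s) = 0"
      unfolding mean_dist_def
      by (subst integral_nonneg_eq_0_iff_AE[symmetric]) (auto intro: integrable_dist l)
    then have "hamming_dist l s = 0" if "s \<in> strings" for s
      using that by (simp add: AE_measure_pmf_iff set_laplace_pmf[OF m r])
    then show False using str_sphere_nonempty[OF l, of 1] by (auto simp: str_sphere_def)
  qed
  moreover have "0 \<le> mean_dist m r l" unfolding mean_dist_def by (intro Bochner_Integration.integral_nonneg) auto
  ultimately show ?thesis by simp
qed

lemma
  assumes l: "l \<in> strings" and r': "0 < r'"
  shows integrable_ln_laplace: "integrable (laplace_pmf m r) (\<lambda>s. ln (pmf (laplace_pmf l r') s))"
    and expectation_ln_laplace: "measure_pmf.expectation (laplace_pmf m r) (\<lambda>s. ln (pmf (laplace_pmf l r') s)) =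
      log_profile (mean_dist m r l) r' - mean_log_sphere m r l"
proof -
  let ?g = "\<lambda>s. real (hamming_dist l s) * ln r' - (real (hamming_dist l s) + 1) * ln (r' + 1) - log_sphere l s"
  have AE: "AE s in laplace_pmf m r. ln (pmf (laplace_pmf l r') s) = ?g s"
    unfolding AE_measure_pmf_iff set_laplace_pmf[OF m r]
    by (simp add: pmf_laplace_pmf[OF l r'] ln_laplace_prob[OF l r'] log_profile_def)
  have int: "integrable (laplace_pmf m r) ?g"
    using integrable_dist[OF l] integrable_log_sphere[OF l] by auto
  show "integrable (laplace_pmf m r) (\<lambda>s. ln (pmf (laplace_pmf l r') s))"
    using int AE by (subst integrable_cong_AE) auto
  have "measure_pmf.expectation (laplace_pmf m r) (\<lambda>s. ln (pmf (laplace_pmf l r') s)) =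
      measure_pmf.expectation (laplace_pmf m r) ?g"
    using AE by (intro integral_cong_AE) auto
  also have "\<dots> = log_profile (mean_dist m r l) r' - mean_log_sphere m r l"
    using integrable_dist[OF l] integrable_log_sphere[OF l]
    by (simp add: log_profile_def mean_dist_def mean_log_sphere_def)
  finally show "measure_pmf.expectation (laplace_pmf m r) (\<lambda>s. ln (pmf (laplace_pmf l r') s)) =
      log_profile (mean_dist m r l) r' - mean_log_sphere m r l" .
qed

text \<open>The left side is the expected log-likelihood at centre \<open>l\<close> with the dispersion that is best for
  \<open>l\<close>. By Gibbs' inequality it is below the one at the true parameters \<open>m\<close> and \<open>r\<close>, which in turn is at
  most the best one for \<open>m\<close>.\<close>

lemma profile_separation:
  assumes l: "l \<in> strings" and neq: "l \<noteq> m"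
  shows "log_profile (mean_dist m r l) (mean_dist m r l) - mean_log_sphere m r l <
    log_profile (mean_dist m r m) (mean_dist m r m) - mean_log_sphere m r m"
proof -
  have D: "0 < mean_dist m r l" "0 < mean_dist m r m" using mean_dist_pos l m by auto
  have "log_profile (mean_dist m r l) (mean_dist m r l) - mean_log_sphere m r l <
      log_profile (mean_dist m r m) r - mean_log_sphere m r m"
    unfolding expectation_ln_laplace[OF l D(1), symmetric] expectation_ln_laplace[OF m r, symmetric]
  proof (rule gibbs_inequality_pmf)
    show "laplace_pmf m r \<noteq> laplace_pmf l (mean_dist m r l)"
      using laplace_pmf_inject[OF l D(1)] neq by metis
  qed (auto simp: set_laplace_pmf m r l D integrable_ln_laplace)
  then show ?thesis using log_profile_le[OF D(2) r] by linarith
qed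

text \<open>The candidates \<open>l\<close> are infinitely many, but all except finitely many are excluded by a crude bound:
  a positive fraction of the sample equals \<open>m\<close>, and each such observation contributes at most
  \<open>- ln (R + 1)\<close> if \<open>l\<close> has distance at least \<open>R\<close> from \<open>m\<close>, whatever the dispersion. For each of the
  finitely many near candidates the best mean log-likelihood converges to a limit that is separated
  from that of \<open>m\<close>. For \<open>l = m\<close> the best dispersion is the mean distance.\<close>

theorem eventually_unique_maximizer:
  fixes x :: "nat \<Rightarrow> 'a str"
  assumes x: "\<And>i. x i \<in> strings"
    and dist: "\<And>l. l \<in> strings \<Longrightarrow>
      (\<lambda>n. (\<Sum>i<n. real (hamming_dist l (x i))) / real n) \<longlonglongrightarrow> mean_dist m r l"
    and sphere: "\<And>l. l \<in> strings \<Longrightarrow> (\<lambda>n. (\<Sum>i<n. log_sphere l (x i)) / real n) \<longlonglongrightarrow> mean_log_sphere m r l"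
    and atom: "(\<lambda>n. (\<Sum>i<n. indicator {m} (x i)) / real n) \<longlonglongrightarrow> pmf (laplace_pmf m r) m"
  defines "D \<equiv> \<lambda>n. (\<Sum>i<n. real (hamming_dist m (x i))) / real n"
  shows "\<forall>\<^sub>F n in sequentially. 0 < D n \<and> (\<forall>l\<in>strings. \<forall>r'>0. (l, r') \<noteq> (m, D n) \<longrightarrow>
    (\<Sum>i<n. ln (laplace_prob hamming_dist l r' (x i))) < (\<Sum>i<n. ln (laplace_prob hamming_dist m (D n) (x i))))"
proof -
  define Dn where "Dn l n = (\<Sum>i<n. real (hamming_dist l (x i))) / real n" for l n
  define An where "An l n = (\<Sum>i<n. log_sphere l (x i)) / real n" for l n
  define V where "V l n = log_profile (Dn l n) (Dn l n) - An l n" for l n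
  define W where "W l = log_profile (mean_dist m r l) (mean_dist m r l) - mean_log_sphere m r l" for l
  have loglik: "(\<Sum>i<n. ln (laplace_prob hamming_dist l p (x i))) = real n * (log_profile (Dn l n) p - An l n)"
    if "l \<in> strings" "0 < p" "0 < n" for l p n
  proof -
    have "(\<Sum>i<n. ln (laplace_prob hamming_dist l p (x i))) =
      (\<Sum>i<n. real (hamming_dist l (x i))) * ln p - ((\<Sum>i<n. real (hamming_dist l (x i))) + real n) * ln (p + 1)
        - (\<Sum>i<n. log_sphere l (x i))"
      using that by (simp add: ln_laplace_prob log_profile_def sum_subtractf sum.distrib
          sum_distrib_right[symmetric])
    moreover have "(\<Sum>i<n. real (hamming_dist l (x i))) = real n * Dn l n"
      "(\<Sum>i<n. log_sphere l (x i)) = real n * An l n"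
      using that(3) by (simp_all add: Dn_def An_def)
    ultimately show ?thesis by (simp add: log_profile_def algebra_simps)
  qed
  have V: "V l \<longlonglongrightarrow> W l" if l: "l \<in> strings" for l
    unfolding V_def W_def log_profile_def Dn_def An_def
    using mean_dist_pos[OF l] dist[OF l] sphere[OF l] by (intro tendsto_intros) auto
  have Dpos: "\<forall>\<^sub>F n in sequentially. 0 < Dn l n" if "l \<in> strings" for l
    using order_tendstoD(1)[OF dist[OF that] mean_dist_pos[OF that]] unfolding Dn_def .
  define q where "q = pmf (laplace_pmf m r) m"
  have q: "0 < q" unfolding q_def by (intro pmf_positive) (simp add: set_laplace_pmf[OF m r] m)
  \<comment> \<open>\<open>R\<close> is so large that far candidates fall short of the limit for \<open>m\<close> by more than 1.\<close>
  obtain R :: nat where R: "exp ((2 / q) * (1 - W m)) < real R"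
    using reals_Archimedean2 by blast
  have R: "1 - W m < q / 2 * ln (real R + 1)"
  proof -
    have "(2 / q) * (1 - W m) < ln (real R + 1)"
      using R by (subst ln_exp[symmetric], subst ln_less_cancel_iff) auto
    then show ?thesis using q by (simp add: field_simps)
  qed
  define near where "near = (\<Union>d<R. str_sphere hamming_dist m d) - {m}"
  have near: "finite near" "near \<subseteq> strings"
    unfolding near_def using finite_str_sphere[OF m] by (auto simp: str_sphere_def)
  have "\<forall>\<^sub>F n in sequentially. \<forall>l\<in>near. 0 < Dn l n"
    using near by (intro eventually_ball_finite ballI Dpos) auto
  moreover have "\<forall>\<^sub>F n in sequentially. \<forall>l\<in>near. 0 < V m n - V l n"
  proof (intro eventually_ball_finite ballI near(1))
    fix l assume l: "l \<in> near"
    then have "0 < W m - W l"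
      using near profile_separation[of l] by (auto simp: W_def near_def)
    then show "\<forall>\<^sub>F n in sequentially. 0 < V m n - V l n"
      using l near(2) by (intro order_tendstoD(1)[OF tendsto_diff[OF V[OF m] V]]) auto
  qed
  moreover have "\<forall>\<^sub>F n in sequentially. q / 2 < (\<Sum>i<n. indicator {m} (x i)) / real n"
    using q by (intro order_tendstoD(1)[OF atom[folded q_def]]) auto
  moreover have "\<forall>\<^sub>F n in sequentially. W m - 1 < V m n"
    by (intro order_tendstoD(1)[OF V[OF m]]) auto
  ultimately show ?thesis
    using Dpos[OF m] eventually_gt_at_top[of 0]
  proof eventually_elim
    case (elim n)
    note near_pos = elim(1) and near_less = elim(2) and freq = elim(3) and Vm = elim(4)
      and Dm = elim(5) and n = elim(6)
    have Dn: "D n = Dn m n" by (simp add: D_def Dn_def)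
    have best: "(\<Sum>i<n. ln (laplace_prob hamming_dist m (D n) (x i))) = real n * V m n"
      using loglik[OF m Dm n] by (simp add: Dn V_def)
    show ?case
    proof (intro conjI ballI allI impI)
      show "0 < D n" using Dm Dn by simp
      fix l :: "'a str" and p :: real
      assume l: "l \<in> strings" and p: "0 < p" and neq: "(l, p) \<noteq> (m, D n)"
      consider "l = m" | "l \<in> near" | "R \<le> hamming_dist m l"
        using l unfolding near_def str_sphere_def by (metis (mono_tags, lifting) DiffI UN_I lessThan_iff
            mem_Collect_eq not_less singletonD)
      then show "(\<Sum>i<n. ln (laplace_prob hamming_dist l p (x i))) <
          (\<Sum>i<n. ln (laplace_prob hamming_dist m (D n) (x i)))"
      proof cases
        case 1
        then have "log_profile (Dn m n) p < log_profile (Dn m n) (Dn m n)"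
          using neq Dn by (intro log_profile_less Dm p) auto
        then show ?thesis unfolding best using loglik[OF l p n] n by (simp add: 1 V_def)
      next
        case 2
        have "log_profile (Dn l n) p - An l n \<le> V l n"
          unfolding V_def using log_profile_le[OF _ p, of "Dn l n"] near_pos 2 by simp
        also have "\<dots> < V m n" using near_less 2 by simp
        finally show ?thesis unfolding best using loglik[OF l p n] n by simp
      next
        case 3
        let ?c = "ln (real R + 1)"
        have "ln (laplace_prob hamming_dist l p (x i)) \<le> - (indicator {m} (x i) * ?c)" for i
        proof -
          have "ln (laplace_prob hamming_dist l p (x i)) \<le> - ln (real (hamming_dist l (x i)) + 1)"
            using ln_laplace_prob[OF l p, of "x i"] log_profile_le_neg_ln[OF p, of "hamming_dist l (x i)"]
              log_sphere_nonneg[OF l, of "x i"] by linarith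
          also have "\<dots> \<le> - (indicator {m} (x i) * ?c)"
            using 3 by (auto simp: indicator_def hamming_dist_commute[of l m])
          finally show ?thesis .
        qed
        then have "(\<Sum>i<n. ln (laplace_prob hamming_dist l p (x i))) \<le> (\<Sum>i<n. - (indicator {m} (x i) * ?c))"
          by (rule sum_mono)
        also have "\<dots> = - ((\<Sum>i<n. indicator {m} (x i)) * ?c)"
          by (simp add: sum_negf sum_distrib_right)
        also have "\<dots> \<le> - (real n * (q / 2) * ?c)"
        proof -
          have "real n * (q / 2) \<le> (\<Sum>i<n. indicator {m} (x i))" using freq n by (simp add: field_simps)
          then have "real n * (q / 2) * ?c \<le> (\<Sum>i<n. indicator {m} (x i)) * ?c" by (rule mult_right_mono) simp
          then show ?thesis by simp
        qed
        also have "\<dots> < real n * V m n"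
        proof -
          have "- (q / 2 * ?c) < V m n" using R Vm by linarith
          then have "real n * - (q / 2 * ?c) < real n * V m n" using n by (intro mult_strict_left_mono) auto
          then show ?thesis by (simp add: mult.assoc)
        qed
        finally show ?thesis unfolding best .
      qed
    qed
  qed
qed

end

lemma likelihood_eq_exp:
  fixes l :: "('a::finite) str"
  assumes "l \<in> strings" "0 < p"
  shows "likelihood hamming_dist (map x [0..<n]) l p =
    exp (\<Sum>i<n. ln (laplace_prob hamming_dist l p (x i)))"
proof -
  have "likelihood hamming_dist (map x [0..<n]) l p = (\<Prod>i<n. laplace_prob hamming_dist l p (x i))"
    unfolding likelihood_def by (simp add: comp_def prod.list_conv_set_nth lessThan_atLeast0)
  also have "\<dots> = exp (\<Sum>i<n. ln (laplace_prob hamming_dist l p (x i)))"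
    using laplace_prob_pos[OF assms] by (simp add: exp_sum)
  finally show ?thesis .
qed

lemma unique_max_likelihood:
  fixes x :: "nat \<Rightarrow> ('a::finite) str"
  assumes m: "m \<in> strings" and r: "0 < r"
    and less: "\<And>l r'. l \<in> strings \<Longrightarrow> 0 < r' \<Longrightarrow> (l, r') \<noteq> (m, r) \<Longrightarrow>
    (\<Sum>i<n. ln (laplace_prob hamming_dist l r' (x i))) < (\<Sum>i<n. ln (laplace_prob hamming_dist m r (x i)))"
  shows "max_likelihood hamming_dist (map x [0..<n]) l' r' \<longleftrightarrow> l' = m \<and> r' = r"
proof -
  have lt: "likelihood hamming_dist (map x [0..<n]) l p < likelihood hamming_dist (map x [0..<n]) m r"
    if "l \<in> strings" "0 < p" "(l, p) \<noteq> (m, r)" for l p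
    using less[OF that] that m r by (simp add: likelihood_eq_exp)
  then have "max_likelihood hamming_dist (map x [0..<n]) m r"
    unfolding max_likelihood_def using m r by (auto simp: less_eq_real_def)
  moreover have "l' = m \<and> r' = r" if "max_likelihood hamming_dist (map x [0..<n]) l' r'"
    using that lt[of l' r'] m r unfolding max_likelihood_def by (metis not_less prod.inject)
  ultimately show ?thesis by blast
qed

section \<open>The estimators\<close>

context laplace_sample
begin

text \<open>All limits that the two eventual statements use hold on one event of probability one, because
  sites, letters and strings are countable.\<close>

lemma AE_sample_averages:
  "AE \<omega> in M. (\<forall>j x. (\<lambda>n. rel_freq (map (\<lambda>i. \<sigma> i \<omega>) [0..<n]) j x) \<longlonglongrightarrow>
      measure_pmf.prob (laplace_pmf lam \<rho>) {s. s j = x}) \<and>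
    (\<forall>l\<in>strings. (\<lambda>n. (\<Sum>i<n. real (hamming_dist l (\<sigma> i \<omega>))) / real n) \<longlonglongrightarrow> mean_dist lam \<rho> l) \<and>
    (\<forall>l\<in>strings. (\<lambda>n. (\<Sum>i<n. log_sphere l (\<sigma> i \<omega>)) / real n) \<longlonglongrightarrow> mean_log_sphere lam \<rho> l) \<and>
    (\<lambda>n. (\<Sum>i<n. indicator {lam} (\<sigma> i \<omega>)) / real n) \<longlonglongrightarrow> pmf (laplace_pmf lam \<rho>) lam"
proof -
  have ind: "AE \<omega> in M. (\<lambda>n. (\<Sum>i<n. indicator A (\<sigma> i \<omega>)) / real n) \<longlonglongrightarrow>
      measure_pmf.prob (laplace_pmf lam \<rho>) A" for A
    using strong_law_sample[of "indicator A" 1 0] by (simp add: indicator_def split: if_splits)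
  have "AE \<omega> in M. \<forall>j x. (\<lambda>n. rel_freq (map (\<lambda>i. \<sigma> i \<omega>) [0..<n]) j x) \<longlonglongrightarrow>
      measure_pmf.prob (laplace_pmf lam \<rho>) {s. s j = x}"
    unfolding AE_all_countable rel_freq_eq_sum by (intro allI ind)
  moreover have "AE \<omega> in M. \<forall>l\<in>strings. (\<lambda>n. (\<Sum>i<n. real (hamming_dist l (\<sigma> i \<omega>))) / real n)
      \<longlonglongrightarrow> mean_dist lam \<rho> l"
    unfolding mean_dist_def
    by (intro AE_ball_countable' countable_strings, rule strong_law_sample[OF hamming_dist_linear_bound[OF _ lam]])
  moreover have "AE \<omega> in M. \<forall>l\<in>strings. (\<lambda>n. (\<Sum>i<n. log_sphere l (\<sigma> i \<omega>)) / real n)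
      \<longlonglongrightarrow> mean_log_sphere lam \<rho> l"
    unfolding mean_log_sphere_def
    by (intro AE_ball_countable' countable_strings, rule strong_law_sample[OF log_sphere_linear_bound[OF _ lam]])
  moreover note ind[of "{lam}", unfolded measure_pmf_single]
  ultimately show ?thesis by eventually_elim blast
qed

end

theorem theorem1:
  fixes M :: "'w measure"
    and \<sigma> :: "nat \<Rightarrow> 'w \<Rightarrow> ('a::finite) str"
    and lam :: "'a str" and \<rho> :: real
    and lam_hat :: "'a str list \<Rightarrow> 'a str" and \<rho>_hat :: "'a str list \<Rightarrow> real"
    and \<eta> :: "'a str list \<Rightarrow> nat \<Rightarrow> 'a option"
  assumes alphabet: "CARD('a) \<ge> 2"
    and prob: "prob_space M"
    and lam: "lam \<in> strings" and \<rho>: "0 < \<rho>"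
    and random: "\<And>i. random_string M (\<sigma> i)"
    and indep: "\<And>n. indep_strings M n \<sigma>"
    and distr: "\<And>i. laplace_distributed M hamming_dist lam \<rho> (\<sigma> i)"
    and mle: "\<And>ss. set ss \<subseteq> strings \<Longrightarrow> \<exists>l r. max_likelihood hamming_dist ss l r \<Longrightarrow>
                max_likelihood hamming_dist ss (lam_hat ss) (\<rho>_hat ss)"
    and modal: "\<And>ss. set ss \<subseteq> strings \<Longrightarrow> modal_letters ss (\<eta> ss)"
  shows "\<exists>\<epsilon>\<^sub>0>0. AE \<omega> in M. \<forall>\<epsilon>. 0 < \<epsilon> \<and> \<epsilon> \<le> \<epsilon>\<^sub>0 \<longrightarrow>
           (\<exists>N\<^sub>0\<ge>1. \<forall>n\<ge>N\<^sub>0.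
              let ss = map (\<lambda>i. \<sigma> i \<omega>) [0..<n];
                  m = truncated_consensus \<epsilon> ss (\<eta> ss)
              in lam_hat ss = m \<and>
                 \<rho>_hat ss = 1 / real n * (\<Sum>i<n. real (hamming_dist (\<sigma> i \<omega>) m)))"
proof -
  interpret laplace_sample M \<sigma> lam \<rho>
    using lam \<rho> random indep distr by (intro laplace_sample.intro prob laplace_sample_axioms.intro)
  obtain \<epsilon>\<^sub>0 where \<epsilon>\<^sub>0: "0 < \<epsilon>\<^sub>0" and consensus: "\<And>ss \<epsilon>.
    (\<And>j x. (\<lambda>n. rel_freq (ss n) j x) \<longlonglongrightarrow> measure_pmf.prob (laplace_pmf lam \<rho>) {s. s j = x}) \<Longrightarrow>
    0 < \<epsilon> \<Longrightarrow> \<epsilon> \<le> \<epsilon>\<^sub>0 \<Longrightarrow>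
    \<forall>\<^sub>F n in sequentially. \<forall>\<eta>. modal_letters (ss n) \<eta> \<longrightarrow> truncated_consensus \<epsilon> (ss n) \<eta> = lam"
    using eventually_truncated_consensus[OF alphabet lam \<rho>] by blast
  show ?thesis
  proof (intro exI[of _ \<epsilon>\<^sub>0] conjI \<epsilon>\<^sub>0)
    show "AE \<omega> in M. \<forall>\<epsilon>. 0 < \<epsilon> \<and> \<epsilon> \<le> \<epsilon>\<^sub>0 \<longrightarrow>
           (\<exists>N\<^sub>0\<ge>1. \<forall>n\<ge>N\<^sub>0.
              let ss = map (\<lambda>i. \<sigma> i \<omega>) [0..<n];
                  m = truncated_consensus \<epsilon> ss (\<eta> ss)
              in lam_hat ss = m \<and>
                 \<rho>_hat ss = 1 / real n * (\<Sum>i<n. real (hamming_dist (\<sigma> i \<omega>) m)))"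
      using AE_sample_averages AE_space
    proof eventually_elim
      case (elim \<omega>)
      define x where "x i = \<sigma> i \<omega>" for i
      define ss where "ss n = map x [0..<n]" for n
      define D where "D n = (\<Sum>i<n. real (hamming_dist lam (x i))) / real n" for n
      have x: "x i \<in> strings" for i using sample_in_strings[OF elim(2)] by (simp add: x_def)
      have ss: "set (ss n) \<subseteq> strings" for n using x by (auto simp: ss_def)
      have mle_eq: "\<forall>\<^sub>F n in sequentially. lam_hat (ss n) = lam \<and> \<rho>_hat (ss n) = D n"
      proof -
        have "\<forall>\<^sub>F n in sequentially. 0 < D n \<and> (\<forall>l\<in>strings. \<forall>r'>0. (l, r') \<noteq> (lam, D n) \<longrightarrow>
            (\<Sum>i<n. ln (laplace_prob hamming_dist l r' (x i)))
              < (\<Sum>i<n. ln (laplace_prob hamming_dist lam (D n) (x i))))"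
          unfolding D_def using elim(1)
          by (intro eventually_unique_maximizer[OF lam \<rho> x]) (simp_all add: x_def)
        then show ?thesis
        proof eventually_elim
          case (elim n)
          then have "max_likelihood hamming_dist (ss n) l r \<longleftrightarrow> l = lam \<and> r = D n" for l r
            unfolding ss_def by (intro unique_max_likelihood lam) auto
          then show ?case using mle[OF ss, of n] by blast
        qed
      qed
      show ?case
      proof (intro allI impI)
        fix \<epsilon> assume "0 < \<epsilon> \<and> \<epsilon> \<le> \<epsilon>\<^sub>0"
        then have "\<forall>\<^sub>F n in sequentially. \<forall>\<eta>. modal_letters (ss n) \<eta> \<longrightarrow> truncated_consensus \<epsilon> (ss n) \<eta> = lam"
          using elim(1) by (intro consensus) (simp_all add: ss_def x_def[abs_def])
        from this mle_eq eventually_ge_at_top[of 1]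
        have "\<forall>\<^sub>F n in sequentially. 1 \<le> n \<and> truncated_consensus \<epsilon> (ss n) (\<eta> (ss n)) = lam \<and>
            lam_hat (ss n) = lam \<and> \<rho>_hat (ss n) = D n"
          by eventually_elim (use modal[OF ss] in auto)
        then obtain N where "\<forall>n\<ge>N. 1 \<le> n \<and> truncated_consensus \<epsilon> (ss n) (\<eta> (ss n)) = lam \<and>
            lam_hat (ss n) = lam \<and> \<rho>_hat (ss n) = D n"
          by (auto simp: eventually_sequentially)
        then show "\<exists>N\<^sub>0\<ge>1. \<forall>n\<ge>N\<^sub>0.
              let ss = map (\<lambda>i. \<sigma> i \<omega>) [0..<n];
                  m = truncated_consensus \<epsilon> ss (\<eta> ss)
              in lam_hat ss = m \<and>
                 \<rho>_hat ss = 1 / real n * (\<Sum>i<n. real (hamming_dist (\<sigma> i \<omega>) m))"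
          by (intro exI[of _ N])
            (simp add: Let_def ss_def x_def[abs_def] D_def hamming_dist_commute[of _ lam])
      qed
    qed
  qed
qed

end
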